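(* If $G$ is a connected graph with at least three vertices, then $$R(G)-\frac{1}{2}D(G)\geq \sqrt{2}-1.$$ Equality holds if and only if $G\cong P_n$ for some $n\geq 3$.
   Context: Graphs are finite and simple. For a graph $G=(V,E)$, $d_u$ denotes the degree of the vertex $u$ in $G$, and the Randić index of $G$ is $R(G)=\sum_{uv\in E}\frac{1}{\sqrt{d_ud_v}}$. $D(G)$ is the diameter of the connected graph $G$ (the maximum distance between two vertices). $P_n$ is the path on $n$ vertices. *)

theory Defs
  imports Complex_Main
begin

definition simple_graph :: "'a set \<Rightarrow> 'a set set \<Rightarrow> bool" where
  "simple_graph V E \<longleftrightarrow> finite V \<and> (\<forall>e\<in>E. e \<subseteq> V \<and> card e = 2)"

definition adj_rel :: "'a set set \<Rightarrow> ('a \<times> 'a) set" where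
  "adj_rel E = {(u, v). {u, v} \<in> E}"

definition graph_connected :: "'a set \<Rightarrow> 'a set set \<Rightarrow> bool" where
  "graph_connected V E \<longleftrightarrow> V \<noteq> {} \<and> (\<forall>u\<in>V. \<forall>v\<in>V. (u, v) \<in> (adj_rel E)\<^sup>*)"

(* A pair is in the k-th relational power of the adjacency relation iff a walk with k edges
   joins its components. The value is unspecified if no walk exists. *)
definition graph_dist :: "'a set set \<Rightarrow> 'a \<Rightarrow> 'a \<Rightarrow> nat" where
  "graph_dist E u v = (LEAST k. (u, v) \<in> adj_rel E ^^ k)"

(* Meaningful only for finite, nonempty, connected graphs. *)
definition diameter :: "'a set \<Rightarrow> 'a set set \<Rightarrow> nat" where
  "diameter V E = Max {graph_dist E u v | u v. u \<in> V \<and> v \<in> V}"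

definition degree :: "'a set set \<Rightarrow> 'a \<Rightarrow> nat" where
  "degree E u = card {e \<in> E. u \<in> e}"

(* For an edge e = {u, v} with u and v distinct, the product over e is the product
   of the degrees of u and v. *)
definition randic_index :: "'a set set \<Rightarrow> real" where
  "randic_index E = (\<Sum>e\<in>E. 1 / sqrt (\<Prod>u\<in>e. real (degree E u)))"

definition graph_iso :: "'a set \<Rightarrow> 'a set set \<Rightarrow> 'b set \<Rightarrow> 'b set set \<Rightarrow> bool" where
  "graph_iso V E V' E' \<longleftrightarrow>
     (\<exists>f. bij_betw f V V' \<and> (\<forall>u\<in>V. \<forall>v\<in>V. {u, v} \<in> E \<longleftrightarrow> {f u, f v} \<in> E'))"

definition path_verts :: "nat \<Rightarrow> nat set" where
  "path_verts n = {..<n}"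

definition path_edges :: "nat \<Rightarrow> nat set set" where
  "path_edges n = {{i, Suc i} | i. Suc i < n}"

end

theory Submission
  imports Defs
begin

text \<open>
  Call \<open>R - D / 2 - (sqrt 2 - 1)\<close> the slack of a connected graph. Paths have slack 0, and a
  connected graph on \<open>n\<close> vertices is a path iff \<open>D = n - 1\<close>. Every other connected graph has slack at
  least \<open>1 / 5\<close>. To see this, take a counterexample with the fewest vertices and a pair \<open>x, y\<close> at
  maximal distance.

  A leaf whose neighbour has degree 2 can be deleted, since this lowers \<open>R\<close> by at least \<open>1 / 2\<close>.
  A non-cut vertex \<open>w\<close> other than \<open>x, y\<close> can be deleted without increasing \<open>R\<close> unless
  some vertex at distance at most 2 has degree below about a quarter of that of \<open>w\<close>. At a cut
  vertex \<open>w\<close> not supporting a leaf, the graph splits into two smaller non-paths, and \<open>R\<close> grows by at most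
  \<open>2 - sqrt 2\<close> unless some neighbour of \<open>w\<close> has degree below half of that of \<open>w\<close>. So apart from at most four
  special vertices near \<open>x\<close> and \<open>y\<close> all degrees are at least 5, and they grow like \<open>2 ^ r\<close> with the
  distance \<open>r\<close> from the special vertices. With maximum degree \<open>\<Delta>\<close>, the bound
  \<open>2 * sqrt \<Delta> * R \<ge> (\<Sum>z. sqrt (d z))\<close> then makes \<open>R\<close> too large for a counterexample, because
  \<open>n \<ge> \<Delta> + D - 1\<close> and \<open>\<Delta>\<close> is exponential in \<open>D / 2\<close>.
\<close>

section \<open>Degrees, edge sums and distances\<close>

definition nbrs :: "'a set set \<Rightarrow> 'a \<Rightarrow> 'a set" where
  "nbrs E v = {u. {v, u} \<in> E}"

definition induced :: "'a set set \<Rightarrow> 'a set \<Rightarrow> 'a set set" where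
  "induced E A = {e \<in> E. e \<subseteq> A}"

text \<open>The real adjacency matrix: sums over edges become symmetric double sums over vertices,
  in which each edge counts twice.\<close>

definition adj_ind :: "'a set set \<Rightarrow> 'a \<Rightarrow> 'a \<Rightarrow> real" where
  "adj_ind E u v = (if {u, v} \<in> E then 1 else 0)"

text \<open>The Randic weight of an edge is the product of \<open>dw\<close> over its ends. At
  degree 0 the value is 0, by division by zero.\<close>

definition dw :: "'a set set \<Rightarrow> 'a \<Rightarrow> real" where
  "dw E v = 1 / sqrt (real (degree E v))"

lemma adj_ind_sym: "adj_ind E u v = adj_ind E v u"
  by (simp add: adj_ind_def insert_commute)

lemma dw_nonneg [simp]: "0 \<le> dw E v"
  by (simp add: dw_def)

lemma sym_adj_rel: "sym (adj_rel E)"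
  by (auto simp: sym_def adj_rel_def insert_commute)

lemma relpow_sym:
  assumes "(u, v) \<in> adj_rel E ^^ k"
  shows "(v, u) \<in> adj_rel E ^^ k"
  using assms
proof (induction k arbitrary: v)
  case (Suc k)
  then obtain y where "(u, y) \<in> adj_rel E ^^ k" "(y, v) \<in> adj_rel E" by auto
  with Suc.IH[of y] have "(y, u) \<in> adj_rel E ^^ k" "(v, y) \<in> adj_rel E"
    using sym_adj_rel[of E] by (auto simp: sym_def)
  then show ?case by (meson relpow_Suc_I2)
qed auto

lemma relpow_subset:
  fixes R S :: "('b \<times> 'b) set"
  shows "R \<subseteq> S \<Longrightarrow> R ^^ k \<subseteq> S ^^ k"
  by (induction k) (simp_all add: relcomp_mono)

lemma graph_dist_le: "(u, v) \<in> adj_rel E ^^ k \<Longrightarrow> graph_dist E u v \<le> k"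
  unfolding graph_dist_def by (rule Least_le)

section \<open>Degrees and edge sums in simple graphs\<close>

locale sgraph =
  fixes V :: "'a set" and E :: "'a set set"
  assumes simple: "simple_graph V E"
begin

lemma finite_V: "finite V"
  using simple by (simp add: simple_graph_def)

lemma edge_subset: "e \<in> E \<Longrightarrow> e \<subseteq> V"
  using simple by (simp add: simple_graph_def)

lemma finite_E: "finite E"
  using finite_V edge_subset by (meson Pow_iff finite_Pow_iff finite_subset subsetI)

lemma edge_neq: "{u, v} \<in> E \<Longrightarrow> u \<noteq> v"
  using simple by (fastforce simp: simple_graph_def)

lemma edge_ends: "{u, v} \<in> E \<Longrightarrow> u \<in> V \<and> v \<in> V"
  using edge_subset by blast

lemma no_loop [simp]: "{u} \<notin> E"
  using edge_neq[of u u] by auto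

lemma nbrs_subset: "nbrs E v \<subseteq> V"
  using edge_ends by (auto simp: nbrs_def)

lemma finite_nbrs: "finite (nbrs E v)"
  using nbrs_subset finite_V finite_subset by blast

lemma nbrs_irrefl: "v \<notin> nbrs E v"
  by (simp add: nbrs_def)

lemma nbrs_sym: "u \<in> nbrs E v \<longleftrightarrow> v \<in> nbrs E u"
  by (simp add: nbrs_def insert_commute)

lemma bij_nbrs: "bij_betw (\<lambda>u. {v, u}) (nbrs E v) {e \<in> E. v \<in> e}"
proof -
  have "e \<in> (\<lambda>u. {v, u}) ` nbrs E v" if "e \<in> E" "v \<in> e" for e
  proof -
    have "card e = 2" using simple that by (simp add: simple_graph_def)
    then obtain a b where "e = {a, b}" by (meson card_2_iff)
    with that show ?thesis by (auto simp: nbrs_def insert_commute)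
  qed
  then show ?thesis
    unfolding bij_betw_def by (auto simp: inj_on_def doubleton_eq_iff nbrs_def)
qed

lemma degree_nbrs: "degree E v = card (nbrs E v)"
  using bij_betw_same_card[OF bij_nbrs] by (simp add: degree_def)

lemma sum_adj_ind: "(\<Sum>v\<in>V. adj_ind E u v * f v) = (\<Sum>v\<in>nbrs E u. f v)"
proof -
  have "(\<Sum>v\<in>V. adj_ind E u v * f v) = (\<Sum>v\<in>V. if {u, v} \<in> E then f v else 0)"
    by (intro sum.cong) (auto simp: adj_ind_def)
  also have "\<dots> = (\<Sum>v\<in>{v\<in>V. {u, v} \<in> E}. f v)"
    by (simp add: sum.inter_filter finite_V)
  also have "{v\<in>V. {u, v} \<in> E} = nbrs E u"
    using nbrs_subset by (auto simp: nbrs_def)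
  finally show ?thesis .
qed

lemma degree_sum: "real (degree E u) = (\<Sum>v\<in>V. adj_ind E u v)"
  using sum_adj_ind[of u "\<lambda>_. 1"] by (simp add: degree_nbrs)

text \<open>Double counting of incidences: each edge is met once from either end. The weight
  \<open>p\<close> is arbitrary because weights of the whole graph are later summed over the edges
  of a subgraph.\<close>

lemma edge_sum:
  fixes p :: "'a \<Rightarrow> real"
  shows "2 * (\<Sum>e\<in>E. \<Prod>u\<in>e. p u) = (\<Sum>u\<in>V. \<Sum>v\<in>V. adj_ind E u v * (p u * p v))"
proof -
  have "(\<Sum>u\<in>V. \<Sum>v\<in>V. adj_ind E u v * (p u * p v)) = (\<Sum>u\<in>V. \<Sum>v\<in>nbrs E u. p u * p v)"
    by (simp add: sum_adj_ind)
  also have "\<dots> = (\<Sum>u\<in>V. \<Sum>v\<in>nbrs E u. \<Prod>x\<in>{u, v}. p x)"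
    using edge_neq by (intro sum.cong refl) (simp add: nbrs_def)
  also have "\<dots> = (\<Sum>u\<in>V. \<Sum>e\<in>{e \<in> E. u \<in> e}. \<Prod>x\<in>e. p x)"
    by (intro sum.cong refl sum.reindex_bij_betw bij_nbrs)
  also have "\<dots> = (\<Sum>e\<in>E. \<Sum>u\<in>{u\<in>V. u \<in> e}. \<Prod>x\<in>e. p x)"
    by (rule sum.swap_restrict) (auto simp: finite_V finite_E)
  also have "\<dots> = (\<Sum>e\<in>E. 2 * (\<Prod>x\<in>e. p x))"
  proof (rule sum.cong)
    fix e assume "e \<in> E"
    then have "{u\<in>V. u \<in> e} = e" "card e = 2"
      using simple by (auto simp: simple_graph_def)
    then show "(\<Sum>u\<in>{u\<in>V. u \<in> e}. \<Prod>x\<in>e. p x) = 2 * (\<Prod>x\<in>e. p x)" by simp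
  qed simp
  finally show ?thesis by (simp add: sum_distrib_left)
qed

lemma randic_edges: "randic_index E = (\<Sum>e\<in>E. \<Prod>u\<in>e. dw E u)"
  unfolding randic_index_def dw_def
proof (rule sum.cong)
  fix e assume "e \<in> E"
  then have "card e = 2" using simple by (simp add: simple_graph_def)
  then obtain a b where "e = {a, b}" "a \<noteq> b" by (meson card_2_iff)
  then show "1 / sqrt (\<Prod>u\<in>e. real (degree E u)) = (\<Prod>u\<in>e. 1 / sqrt (real (degree E u)))"
    by (simp add: real_sqrt_mult)
qed simp

lemma randic_sum:
  "2 * randic_index E = (\<Sum>u\<in>V. \<Sum>v\<in>V. adj_ind E u v * (dw E u * dw E v))"
  unfolding randic_edges by (rule edge_sum)

text \<open>The row and the column of \<open>w\<close> contribute equally by symmetry, and the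
  diagonal entry is 0. This isolates the terms that change when \<open>w\<close> is deleted or
  reweighted.\<close>

lemma adj_sum_split_vertex:
  assumes "w \<in> V"
  shows "(\<Sum>u\<in>V. \<Sum>v\<in>V. adj_ind E u v * (p u * p v))
    = (\<Sum>u\<in>V - {w}. \<Sum>v\<in>V - {w}. adj_ind E u v * (p u * p v)) + 2 * (p w * (\<Sum>z\<in>nbrs E w. p z))"
proof -
  have ww: "adj_ind E w w = 0" by (simp add: adj_ind_def)
  have nb: "(\<Sum>v\<in>V - {w}. adj_ind E w v * p v) = (\<Sum>z\<in>nbrs E w. p z)"
    unfolding sum_adj_ind[symmetric] using ww
    by (subst sum.remove[OF finite_V assms]) simp
  have "(\<Sum>u\<in>V. \<Sum>v\<in>V. adj_ind E u v * (p u * p v))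
     = (\<Sum>v\<in>V - {w}. adj_ind E w v * (p w * p v)) + (\<Sum>u\<in>V - {w}. adj_ind E u w * (p u * p w))
      + (\<Sum>u\<in>V - {w}. \<Sum>v\<in>V - {w}. adj_ind E u v * (p u * p v))"
    using ww by (simp add: sum.remove[OF finite_V assms] sum.distrib)
  also have "(\<Sum>v\<in>V - {w}. adj_ind E w v * (p w * p v)) = p w * (\<Sum>v\<in>V - {w}. adj_ind E w v * p v)"
    by (simp add: sum_distrib_left mult_ac)
  also have "(\<Sum>u\<in>V - {w}. adj_ind E u w * (p u * p w)) = p w * (\<Sum>v\<in>V - {w}. adj_ind E w v * p v)"
    by (simp add: sum_distrib_left mult_ac adj_ind_sym[of E _ w])
  finally show ?thesis by (simp add: nb)
qed

lemma sgraph_induced: "A \<subseteq> V \<Longrightarrow> sgraph A (induced E A)"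
  using simple finite_V
  by unfold_locales (auto simp: simple_graph_def induced_def intro: finite_subset)

lemma induced_edge: "{u, v} \<in> induced E A \<longleftrightarrow> {u, v} \<in> E \<and> u \<in> A \<and> v \<in> A"
  by (auto simp: induced_def)

lemma adj_ind_induced: "u \<in> A \<Longrightarrow> v \<in> A \<Longrightarrow> adj_ind (induced E A) u v = adj_ind E u v"
  by (simp add: adj_ind_def induced_edge)

lemma nbrs_induced: "v \<in> A \<Longrightarrow> nbrs (induced E A) v = nbrs E v \<inter> A"
  by (auto simp: nbrs_def induced_edge)

lemma degree_induced:
  assumes "A \<subseteq> V" "v \<in> A"
  shows "degree (induced E A) v = card (nbrs E v \<inter> A)"
  using sgraph.degree_nbrs[OF sgraph_induced[OF assms(1)]] nbrs_induced[OF assms(2)] by metis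

end

section \<open>Distance layers and the diameter of connected graphs\<close>

locale cgraph = sgraph +
  assumes connected: "graph_connected V E"
begin

lemma nonempty: "V \<noteq> {}"
  using connected by (simp add: graph_connected_def)

lemma rtrancl_adj: "u \<in> V \<Longrightarrow> v \<in> V \<Longrightarrow> (u, v) \<in> (adj_rel E)\<^sup>*"
  using connected by (simp add: graph_connected_def)

lemma dist_walk:
  assumes "u \<in> V" "v \<in> V"
  shows "(u, v) \<in> adj_rel E ^^ graph_dist E u v"
  unfolding graph_dist_def using rtrancl_adj[OF assms] by (meson LeastI rtrancl_imp_relpow)

lemma dist_refl [simp]: "graph_dist E u u = 0"
  using graph_dist_le[where k = 0] by force

lemma dist_0_iff: "u \<in> V \<Longrightarrow> v \<in> V \<Longrightarrow> graph_dist E u v = 0 \<longleftrightarrow> u = v"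
  using dist_walk[of u v] by auto

lemma dist_triangle:
  assumes "u \<in> V" "v \<in> V" "x \<in> V"
  shows "graph_dist E u x \<le> graph_dist E u v + graph_dist E v x"
  using dist_walk[of u v] dist_walk[of v x] assms
  by (intro graph_dist_le) (auto simp: relpow_add)

lemma dist_sym:
  assumes "u \<in> V" "v \<in> V"
  shows "graph_dist E u v = graph_dist E v u"
  using assms dist_walk graph_dist_le relpow_sym by (metis le_antisym)

lemma dist_adj:
  assumes "{u, v} \<in> E"
  shows "graph_dist E u v \<le> 1"
  using assms by (intro graph_dist_le) (auto simp: adj_rel_def)

lemma dist_adj_step:
  assumes "x \<in> V" "{u, v} \<in> E"
  shows "graph_dist E x v \<le> graph_dist E x u + 1"
  using dist_triangle[of x u v] dist_adj[OF assms(2)] edge_ends[OF assms(2)] assms(1) by force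

lemma dist_relpow_V:
  assumes "u \<in> V" "(u, v) \<in> adj_rel E ^^ k"
  shows "v \<in> V"
  using assms(2,1) edge_ends by (cases k) (auto simp: adj_rel_def)

text \<open>Cutting a shortest walk after \<open>i\<close> steps bounds both distances from above;
  the triangle inequality makes both bounds sharp.\<close>

lemma geodesic_vertex:
  assumes "x \<in> V" "y \<in> V" "i \<le> graph_dist E x y"
  obtains v where "v \<in> V" "graph_dist E x v = i" "graph_dist E v y = graph_dist E x y - i"
proof -
  define D where "D = graph_dist E x y"
  have "(x, y) \<in> adj_rel E ^^ (i + (D - i))"
    using dist_walk assms by (simp add: D_def)
  then obtain v where v: "(x, v) \<in> adj_rel E ^^ i" "(v, y) \<in> adj_rel E ^^ (D - i)"
    by (auto simp: relpow_add)
  have vV: "v \<in> V" using dist_relpow_V[OF assms(1) v(1)] .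
  have "graph_dist E x v \<le> i" "graph_dist E v y \<le> D - i" using graph_dist_le v by fast+
  moreover have "D \<le> graph_dist E x v + graph_dist E v y"
    using dist_triangle[of x v y] assms vV by (simp add: D_def)
  ultimately have "graph_dist E x v = i" "graph_dist E v y = D - i"
    using assms(3) by (auto simp: D_def)
  with vV show ?thesis using that by (simp add: D_def)
qed

lemma diam_set: "{graph_dist E u v | u v. u \<in> V \<and> v \<in> V} = (\<lambda>(u, v). graph_dist E u v) ` (V \<times> V)"
  by auto

lemma dist_le_diameter: "u \<in> V \<Longrightarrow> v \<in> V \<Longrightarrow> graph_dist E u v \<le> diameter V E"
  unfolding diameter_def diam_set by (intro Max_ge) (auto simp: finite_V)

lemma diameter_attained:
  obtains x y where "x \<in> V" "y \<in> V" "graph_dist E x y = diameter V E"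
proof -
  have "diameter V E \<in> (\<lambda>(u, v). graph_dist E u v) ` (V \<times> V)"
    unfolding diameter_def diam_set using nonempty by (intro Max_in) (auto simp: finite_V)
  then show ?thesis using that by auto
qed

lemma diameter_leI:
  assumes "\<And>u v. u \<in> V \<Longrightarrow> v \<in> V \<Longrightarrow> graph_dist E u v \<le> k"
  shows "diameter V E \<le> k"
  using assms diameter_attained by metis

text \<open>No layer around \<open>x\<close> up to the distance of \<open>y\<close> is empty, so
  each index in \<open>I\<close> supplies its own vertex outside \<open>B\<close>. In the
  applications \<open>B\<close> is empty or a closed neighbourhood, which meets few layers.\<close>

lemma layer_count:
  assumes "x \<in> V" "y \<in> V" "I \<subseteq> {..graph_dist E x y}" "finite B" "B \<subseteq> V"
    and "\<And>v. v \<in> B \<Longrightarrow> graph_dist E x v \<notin> I"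
  shows "card I + card B \<le> card V"
proof -
  have "\<exists>v\<in>V. graph_dist E x v = i" if "i \<in> I" for i
    using geodesic_vertex[OF assms(1,2), of i] that assms(3) by blast
  then obtain g where g: "\<And>i. i \<in> I \<Longrightarrow> g i \<in> V \<and> graph_dist E x (g i) = i" by metis
  have inj: "inj_on g I" using g by (metis inj_onI)
  have "finite I" using assms(3) finite_subset by blast
  have "card I + card B = card (g ` I) + card B" using inj by (simp add: card_image)
  also have "\<dots> = card (g ` I \<union> B)"
    using \<open>finite I\<close> assms(4,6) g by (subst card_Un_disjoint) fastforce+
  also have "\<dots> \<le> card V" using g assms(5) by (intro card_mono finite_V) auto
  finally show ?thesis .
qed

lemma diameter_less_card: "diameter V E < card V"
proof -
  obtain x y where xy: "x \<in> V" "y \<in> V" "graph_dist E x y = diameter V E"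
    using diameter_attained .
  show ?thesis using layer_count[of x y "{..graph_dist E x y}" "{}"] xy by simp
qed

text \<open>A closed neighbourhood meets at most three consecutive layers, and each of the other
  layers, at least \<open>diameter V E - 2\<close> many, adds a vertex.\<close>

lemma degree_diameter:
  assumes "u \<in> V"
  shows "degree E u + diameter V E \<le> card V + 1"
proof -
  obtain x y where xy: "x \<in> V" "y \<in> V" "graph_dist E x y = diameter V E"
    using diameter_attained .
  define l where "l = graph_dist E x u"
  \<comment> \<open>For \<open>l = 0\<close> the truncated \<open>l - 1\<close> is 0, so the removed
    interval still covers the layers of \<open>u\<close> and its neighbours.\<close>
  define I where "I = {..diameter V E} - {l - 1..l + 1}"
  have "graph_dist E x v \<notin> I" if "v \<in> insert u (nbrs E u)" for v
  proof (cases "v = u")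
    case False
    then have "{u, v} \<in> E" "{v, u} \<in> E" using that by (auto simp: nbrs_def insert_commute)
    from this[THEN dist_adj_step[OF xy(1)]] show ?thesis by (auto simp: I_def l_def)
  qed (auto simp: I_def l_def)
  then have "card I + card (insert u (nbrs E u)) \<le> card V"
    using xy assms nbrs_subset finite_nbrs by (intro layer_count[of x y]) (auto simp: I_def)
  moreover have "card {..diameter V E} - card {l - 1..l + 1} \<le> card I"
    unfolding I_def by (rule diff_card_le_card_Diff) simp
  moreover have "card {l - 1..l + 1} \<le> 3" by simp
  moreover have "card (insert u (nbrs E u)) = degree E u + 1"
    by (simp add: finite_nbrs nbrs_irrefl degree_nbrs)
  ultimately show ?thesis by simp
qed

text \<open>The neighbourhood of an end of a diametral pair meets only layers 0 and 1, which
  improves the general bound by one.\<close>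

lemma degree_diameter_end:
  assumes xy: "x \<in> V" "y \<in> V" "graph_dist E x y = diameter V E"
  shows "degree E x + diameter V E \<le> card V"
proof -
  have "graph_dist E x v \<notin> {2..diameter V E}" if "v \<in> insert x (nbrs E x)" for v
    using that dist_adj[of x v] by (cases "v = x") (auto simp: nbrs_def)
  then have "card {2..diameter V E} + card (insert x (nbrs E x)) \<le> card V"
    using xy nbrs_subset finite_nbrs by (intro layer_count[of x y]) auto
  moreover have "card (insert x (nbrs E x)) = degree E x + 1"
    by (simp add: finite_nbrs nbrs_irrefl degree_nbrs)
  ultimately show ?thesis by simp
qed

lemma degree_pos:
  assumes "v \<in> V" "card V \<ge> 2"
  shows "degree E v \<ge> 1"
proof -
  have "V \<noteq> {v}" using assms by auto
  then obtain u where u: "u \<in> V" "u \<noteq> v" using assms by blast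
  then have "(v, u) \<in> (adj_rel E)\<^sup>*" using rtrancl_adj assms by simp
  with u obtain w where "(v, w) \<in> adj_rel E" by (metis converse_rtranclE)
  then have "w \<in> nbrs E v" by (simp add: adj_rel_def nbrs_def)
  then show ?thesis using finite_nbrs[of v] by (auto simp: degree_nbrs Suc_le_eq card_gt_0_iff)
qed

lemma diameter_pos: "card V \<ge> 2 \<Longrightarrow> diameter V E \<ge> 1"
proof -
  assume "card V \<ge> 2"
  then obtain u v where "u \<in> V" "v \<in> V" "u \<noteq> v"
    by (metis card_2_iff' card_le_Suc0_iff_eq finite_V not_less_eq_eq numeral_2_eq_2)
  then show ?thesis using dist_le_diameter[of u v] dist_0_iff[of u v] by linarith
qed

end

section \<open>Deleting a vertex and splitting at a vertex\<close>

text \<open>\<open>phi k / sqrt k\<close> is the increase of \<open>1 / sqrt k\<close> at a vertex of degree \<open>k\<close> that loses one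
  neighbour, multiplied by the number \<open>k - 1\<close> of the remaining neighbours.\<close>

definition phi :: "nat \<Rightarrow> real" where
  "phi k = sqrt (real k * (real k - 1)) - (real k - 1)"

lemma phi_le_half: "k \<ge> 1 \<Longrightarrow> phi k \<le> 1 / 2"
proof -
  assume "k \<ge> 1"
  have "real k * (real k - 1) \<le> (real k - 1 / 2)\<^sup>2" by (simp add: power2_eq_square algebra_simps)
  then have "sqrt (real k * (real k - 1)) \<le> real k - 1 / 2"
    using \<open>k \<ge> 1\<close> by (intro real_le_lsqrt) auto
  then show ?thesis by (simp add: phi_def)
qed

lemma phi_nonneg: "k \<ge> 1 \<Longrightarrow> 0 \<le> phi k"
proof -
  assume "k \<ge> 1"
  then have "real k - 1 \<le> sqrt (real k * (real k - 1))"
    by (intro real_le_rsqrt) (simp add: power2_eq_square mult_right_mono)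
  then show ?thesis by (simp add: phi_def)
qed

text \<open>The bound 1/2 only shows that a deletion does not increase the index; this sharper one
  yields a definite gain when the remaining graph is a path.\<close>

lemma phi_le_small: "1 \<le> k \<Longrightarrow> k \<le> 3 \<Longrightarrow> phi k \<le> 9 / 20"
proof -
  assume "1 \<le> k" "k \<le> 3"
  then have "k = 1 \<or> k = 2 \<or> k = 3" by auto
  moreover have "sqrt 2 \<le> 29 / 20" "sqrt 6 \<le> 49 / 20"
    by (rule real_le_lsqrt, simp add: power2_eq_square, simp add: power2_eq_square)+
  ultimately show ?thesis by (auto simp: phi_def)
qed

lemma phi_alt:
  assumes "k \<ge> 1"
  shows "(1 / sqrt (real (k - 1)) - 1 / sqrt (real k)) * real (k - 1) = 1 / sqrt (real k) * phi k"
proof -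
  define s t where "s = sqrt (real k)" and "t = sqrt (real (k - 1))"
  have st: "s > 0" "t \<ge> 0" "s * s = real k" "t * t = real (k - 1)" "real k - 1 = real (k - 1)"
    using assms by (auto simp: s_def t_def)
  have "phi k = s * t - t * t"
    unfolding phi_def st(5) by (simp add: s_def t_def real_sqrt_mult)
  moreover have "(1 / t - 1 / s) * (t * t) = 1 / s * (s * t - t * t)"
    \<comment> \<open>The case \<open>t = 0\<close> is \<open>k = 1\<close>, where both sides
      vanish.\<close>
    using st(1) by (cases "t = 0") (auto simp: field_simps)
  ultimately show ?thesis using st(4) by (simp add: s_def t_def)
qed

section \<open>Deletion of a vertex and the Randic index\<close>

context cgraph
begin

text \<open>Deleting \<open>w\<close> changes the weight of another edge \<open>uv\<close> by
  \<open>q u * q v - p u * p v = ((q u - p u) * (p v + q v) + (q v - p v) * (p u + q u)) / 2\<close>,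
  and \<open>q\<close> differs from \<open>p\<close> only at the neighbours of \<open>w\<close>.\<close>

lemma removal_gain:
  assumes w: "w \<in> V" and E': "E' = induced E (V - {w})" and c': "cgraph (V - {w}) E'"
    and n: "card V \<ge> 3"
    and bound: "\<And>z v. z \<in> nbrs E w \<Longrightarrow> v \<in> nbrs E z - {w} \<Longrightarrow> (dw E v + dw E' v) / 2 \<le> c"
  shows "randic_index E - randic_index E' \<ge> (\<Sum>z\<in>nbrs E w. dw E z * (dw E w - c * phi (degree E z)))"
proof -
  interpret H: cgraph "V - {w}" E' by (rule c')
  define U where "U = V - {w}"
  define p q where "p = dw E" and "q = dw E'"
  define a where "a = adj_ind E"
  have finU: "finite U" by (simp add: U_def finite_V)
  have nU: "nbrs E w \<subseteq> U" using nbrs_subset nbrs_irrefl by (auto simp: U_def)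
  have deg': "degree E' v = (if v \<in> nbrs E w then degree E v - 1 else degree E v)" if "v \<in> U" for v
  proof -
    have "nbrs E v \<inter> (V - {w}) = nbrs E v - {w}" using nbrs_subset by auto
    moreover have "w \<in> nbrs E v \<longleftrightarrow> v \<in> nbrs E w" by (rule nbrs_sym)
    ultimately show ?thesis
      using that degree_induced[of "V - {w}" v] finite_nbrs
      by (auto simp: U_def E' degree_nbrs)
  qed
  have degpos: "degree E v \<ge> 1" if "v \<in> V" for v using degree_pos[OF that] n by simp
  have R: "2 * randic_index E = (\<Sum>u\<in>U. \<Sum>v\<in>U. a u v * (p u * p v)) + 2 * (p w * (\<Sum>z\<in>nbrs E w. p z))"
    unfolding randic_sum adj_sum_split_vertex[OF w] U_def p_def a_def by simp
  have R': "2 * randic_index E' = (\<Sum>u\<in>U. \<Sum>v\<in>U. a u v * (q u * q v))"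
    unfolding H.randic_sum U_def q_def a_def
    by (intro sum.cong refl) (simp add: E' adj_ind_induced)
  \<comment> \<open>By symmetry of the adjacency matrix, each of the two halves of the identity sums
    to \<open>S\<close>.\<close>
  define S where "S = (\<Sum>u\<in>U. \<Sum>v\<in>U. a u v * ((q u - p u) * ((p v + q v) / 2)))"
  have "(\<Sum>u\<in>U. \<Sum>v\<in>U. a u v * ((q v - p v) * ((p u + q u) / 2))) = S"
    unfolding S_def by (subst sum.swap) (simp add: a_def adj_ind_sym)
  moreover have "(\<Sum>u\<in>U. \<Sum>v\<in>U. a u v * (q u * q v)) - (\<Sum>u\<in>U. \<Sum>v\<in>U. a u v * (p u * p v))
      = S + (\<Sum>u\<in>U. \<Sum>v\<in>U. a u v * ((q v - p v) * ((p u + q u) / 2)))"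
    unfolding S_def sum_subtractf[symmetric] sum.distrib[symmetric]
    by (intro sum.cong refl) (simp add: field_simps)
  ultimately have diff: "randic_index E - randic_index E' = p w * (\<Sum>z\<in>nbrs E w. p z) - S"
    using R R' by simp
  have "S = (\<Sum>u\<in>U. (q u - p u) * (\<Sum>v\<in>U. a u v * ((p v + q v) / 2)))"
    unfolding S_def sum_distrib_left by (intro sum.cong refl) simp
  also have "\<dots> = (\<Sum>u\<in>nbrs E w. (q u - p u) * (\<Sum>v\<in>U. a u v * ((p v + q v) / 2)))"
    using nU finU deg' by (intro sum.mono_neutral_right) (auto simp: p_def q_def dw_def)
  also have "\<dots> \<le> (\<Sum>z\<in>nbrs E w. c * (p z * phi (degree E z)))"
  proof (rule sum_mono)
    fix z assume z: "z \<in> nbrs E w"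
    then have zU: "z \<in> U" and zV: "z \<in> V" using nU U_def by auto
    have d1: "degree E z \<ge> 1" using degpos zV .
    have "degree E' z \<ge> 1"
      using n w zU H.degree_pos[of z] by (simp add: U_def)
    \<comment> \<open>\<open>z\<close> keeps a neighbour after the deletion, so its new weight is
      not the default value 0 and really is at least the old one.\<close>
    then have d2: "degree E z \<ge> 2" using deg'[OF zU] z by simp
    have "q z \<ge> p z"
      unfolding p_def q_def dw_def using deg'[OF zU] z d2 by (intro divide_left_mono) auto
    have aU: "(\<Sum>v\<in>U. a z v * f v) = (\<Sum>v\<in>nbrs E z - {w}. f v)" for f
    proof -
      have "(\<Sum>v\<in>U. a z v * f v) = (\<Sum>v\<in>U. adj_ind E' z v * f v)"
        using zU by (intro sum.cong refl) (simp add: a_def E' U_def adj_ind_induced)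
      also have "\<dots> = (\<Sum>v\<in>nbrs E' z. f v)" using H.sum_adj_ind by (simp add: U_def)
      also have "nbrs E' z = nbrs E z - {w}"
        using nbrs_induced[of z "V - {w}"] zU nbrs_subset by (auto simp: E' U_def)
      finally show ?thesis .
    qed
    have "(\<Sum>v\<in>U. a z v * ((p v + q v) / 2)) \<le> (\<Sum>v\<in>nbrs E z - {w}. c)"
      unfolding aU using bound[OF z] by (intro sum_mono) (simp add: p_def q_def)
    also have "\<dots> = c * real (degree E z - 1)"
      using z by (simp add: degree_nbrs finite_nbrs nbrs_sym)
    finally have "(q z - p z) * (\<Sum>v\<in>U. a z v * ((p v + q v) / 2))
        \<le> (q z - p z) * (c * real (degree E z - 1))"
      using \<open>q z \<ge> p z\<close> by (intro mult_left_mono) auto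
    also have "\<dots> = c * ((1 / sqrt (real (degree E z - 1)) - 1 / sqrt (real (degree E z))) * real (degree E z - 1))"
      using deg'[OF zU] z by (simp add: p_def q_def dw_def)
    also have "\<dots> = c * (p z * phi (degree E z))"
      unfolding phi_alt[OF d1] by (simp add: p_def dw_def)
    finally show "(q z - p z) * (\<Sum>v\<in>U. a z v * ((p v + q v) / 2)) \<le> c * (p z * phi (degree E z))" .
  qed
  finally have "S \<le> (\<Sum>z\<in>nbrs E w. c * (p z * phi (degree E z)))" .
  moreover have "(\<Sum>z\<in>nbrs E w. p z * (p w - c * phi (degree E z)))
      = p w * (\<Sum>z\<in>nbrs E w. p z) - (\<Sum>z\<in>nbrs E w. c * (p z * phi (degree E z)))"
    unfolding sum_distrib_left sum_subtractf[symmetric]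
    by (intro sum.cong refl) (simp add: algebra_simps)
  ultimately show ?thesis using diff by (simp add: p_def)
qed

text \<open>Each neighbour of \<open>z\<close> has weight at least \<open>1 / sqrt m\<close>, and
  the \<open>degree E z\<close> neighbours times the weight of \<open>z\<close> give
  \<open>sqrt (degree E z)\<close>.\<close>

lemma randic_degree_bound:
  assumes "\<And>v. v \<in> V \<Longrightarrow> degree E v \<le> m" "m > 0"
  shows "2 * sqrt (real m) * randic_index E \<ge> (\<Sum>z\<in>V. sqrt (real (degree E z)))"
proof -
  have *: "adj_ind E z v * (1 / sqrt (real m)) \<le> adj_ind E z v * dw E v" if "v \<in> V" "z \<in> V" for z v
  proof (cases "{z, v} \<in> E")
    case True
    then have "degree E v > 0"
      using finite_nbrs[of v] by (auto simp: degree_nbrs card_gt_0_iff nbrs_def insert_commute)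
    then show ?thesis
      using assms(1)[OF that(1)] by (auto simp: adj_ind_def dw_def intro!: divide_left_mono)
  qed (simp add: adj_ind_def)
  have "(\<Sum>z\<in>V. sqrt (real (degree E z))) / sqrt (real m)
      = (\<Sum>z\<in>V. dw E z * (real (degree E z) * (1 / sqrt (real m))))"
    unfolding sum_divide_distrib dw_def
    by (intro sum.cong refl) (simp add: real_div_sqrt)
  also have "\<dots> = (\<Sum>z\<in>V. dw E z * (\<Sum>v\<in>V. adj_ind E z v * (1 / sqrt (real m))))"
    by (simp add: degree_sum sum_distrib_right sum_divide_distrib)
  also have "\<dots> \<le> (\<Sum>z\<in>V. dw E z * (\<Sum>v\<in>V. adj_ind E z v * dw E v))"
    by (intro sum_mono mult_left_mono[OF _ dw_nonneg] *)
  also have "\<dots> = 2 * randic_index E"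
    unfolding randic_sum sum_distrib_left by (intro sum.cong refl) simp
  finally show ?thesis using assms(2) by (simp add: field_simps)
qed

end

section \<open>Splitting a connected graph at a vertex\<close>

context cgraph
begin

lemma dist_induced:
  assumes c: "cgraph A (induced E A)" and uv: "u \<in> A" "v \<in> A"
  shows "graph_dist E u v \<le> graph_dist (induced E A) u v"
proof -
  have sub: "adj_rel (induced E A) \<subseteq> adj_rel E" by (auto simp: adj_rel_def induced_def)
  show ?thesis
    using relpow_subset[OF sub] cgraph.dist_walk[OF c uv] by (intro graph_dist_le) blast
qed

end

text \<open>The vertex \<open>w\<close> belongs to both sides, so the two induced subgraphs are
  connected and partition the edges.\<close>

locale vertex_split = cgraph +
  fixes A B :: "'a set" and w :: 'a
  assumes cover: "V = A \<union> B" and meet: "A \<inter> B = {w}"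
    and no_cross: "\<And>e. e \<in> E \<Longrightarrow> e \<subseteq> A \<or> e \<subseteq> B"
begin

lemma vertex_split_swap: "vertex_split V E B A w"
proof unfold_locales
  show "V = B \<union> A" using cover by (rule trans) (rule Un_commute)
  show "B \<inter> A = {w}" using meet by (simp add: Int_commute)
  show "e \<subseteq> B \<or> e \<subseteq> A" if "e \<in> E" for e using no_cross[OF that] by (rule disj_commute[THEN iffD1])
qed

lemma A_subset: "A \<subseteq> V" and w_in: "w \<in> A" "w \<in> V"
  using cover meet by auto

lemma nbrs_A: "v \<in> A - {w} \<Longrightarrow> nbrs E v \<subseteq> A"
proof
  fix u assume "v \<in> A - {w}" "u \<in> nbrs E v"
  then have "{v, u} \<in> E" "v \<notin> B" using meet by (auto simp: nbrs_def)
  then show "u \<in> A" using no_cross by blast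
qed

text \<open>A walk from \<open>A\<close> towards \<open>w\<close> cannot leave \<open>A\<close>
  before it reaches \<open>w\<close>, so every vertex of \<open>A\<close> is joined to
  \<open>w\<close> inside \<open>A\<close>.\<close>

lemma cgraph_A: "cgraph A (induced E A)"
proof -
  have to_w: "(a, w) \<in> (adj_rel (induced E A))\<^sup>*" if "(a, w) \<in> (adj_rel E)\<^sup>*" "a \<in> A" for a
    using that
  proof (induction rule: converse_rtrancl_induct)
    case (step a b)
    show ?case
    proof (cases "a = w")
      case False
      then have "b \<in> A" using nbrs_A[of a] step by (auto simp: adj_rel_def nbrs_def)
      then have "(a, b) \<in> adj_rel (induced E A)"
        using step by (auto simp: adj_rel_def induced_edge)
      then show ?thesis using step \<open>b \<in> A\<close> by (meson converse_rtrancl_into_rtrancl)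
    qed simp
  qed simp
  have w: "(a, w) \<in> (adj_rel (induced E A))\<^sup>*" if "a \<in> A" for a
    using to_w rtrancl_adj A_subset w_in that by blast
  have "(w, a) \<in> (adj_rel (induced E A))\<^sup>*" if "a \<in> A" for a
    using symD[OF sym_rtrancl[OF sym_adj_rel] w[OF that]] .
  with w have "graph_connected A (induced E A)"
    unfolding graph_connected_def using w_in(1) by (auto intro: rtrancl_trans)
  with sgraph_induced[OF A_subset] show ?thesis
    by (simp add: cgraph_def cgraph_axioms_def)
qed

lemma degree_A: "v \<in> A - {w} \<Longrightarrow> degree (induced E A) v = degree E v"
  using degree_induced[OF A_subset, of v] nbrs_A[of v] by (simp add: degree_nbrs Int_absorb2)

lemma dist_A:
  assumes "u \<in> A" "v \<in> A"
  shows "graph_dist E u v \<le> diameter A (induced E A)"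
  using dist_induced[OF cgraph_A assms] cgraph.dist_le_diameter[OF cgraph_A assms] by simp

lemma diameter_split: "diameter V E \<le> diameter A (induced E A) + diameter B (induced E B)"
proof (rule diameter_leI)
  interpret S: vertex_split V E B A w by (rule vertex_split_swap)
  fix u v assume uv: "u \<in> V" "v \<in> V"
  show "graph_dist E u v \<le> diameter A (induced E A) + diameter B (induced E B)"
  proof (cases "u \<in> A")
    case u: True
    show ?thesis
    proof (cases "v \<in> A")
      case True
      then show ?thesis using dist_A[OF u True] by simp
    next
      case False
      then have "v \<in> B" using uv cover by blast
      then show ?thesis
        using dist_triangle[OF uv(1) w_in(2) uv(2)] dist_A[OF u w_in(1)] S.dist_A[OF S.w_in(1), of v] by simp
    qed
  next
    case False
    then have u: "u \<in> B" using uv cover by blast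
    show ?thesis
    proof (cases "v \<in> B")
      case True
      then show ?thesis using S.dist_A[OF u True] by simp
    next
      case False
      then have "v \<in> A" using uv cover by blast
      then show ?thesis
        using dist_triangle[OF uv(1) w_in(2) uv(2)] S.dist_A[OF u S.w_in(1)] dist_A[OF w_in(1), of v] by simp
    qed
  qed
qed

text \<open>Compares the index of the side \<open>A\<close> with its share of the index of the whole
  graph. Only \<open>w\<close> changes degree, from \<open>t\<close> to \<open>a\<close>; by
  \<open>half\<close>, each of its \<open>a\<close> neighbours in \<open>A\<close> has weight at
  most \<open>sqrt 2 / sqrt t\<close>.\<close>

lemma randic_A:
  assumes half: "\<And>z. z \<in> nbrs E w \<Longrightarrow> degree E w \<le> 2 * degree E z" and n: "card A \<ge> 2"
  defines "a \<equiv> card (nbrs E w \<inter> A)" and "t \<equiv> degree E w"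
  shows "randic_index (induced E A) - (\<Sum>e\<in>induced E A. \<Prod>u\<in>e. dw E u)
    \<le> sqrt 2 * (sqrt a / sqrt t - a / t)"
    and "1 \<le> a"
proof -
  interpret GA: cgraph A "induced E A" by (rule cgraph_A)
  have degw: "degree (induced E A) w = a"
    using degree_induced[OF A_subset w_in(1)] by (simp add: a_def)
  then show a1: "1 \<le> a" using GA.degree_pos[OF w_in(1) n] by simp
  have at: "a \<le> t" unfolding a_def t_def degree_nbrs by (rule card_mono) (auto simp: finite_nbrs)
  define p q where "p = dw E" and "q = dw (induced E A)"
  have pq: "p v = q v" if "v \<in> A - {w}" for v
    using degree_A[OF that] by (simp add: p_def q_def dw_def)
  define N where "N = nbrs (induced E A) w"
  have NA: "N = nbrs E w \<inter> A" by (simp add: N_def nbrs_induced w_in)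
  have "(\<Sum>z\<in>N. p z) = (\<Sum>z\<in>N. q z)"
    using NA nbrs_irrefl[of w] by (intro sum.cong pq) auto
  moreover have "(\<Sum>u\<in>A - {w}. \<Sum>v\<in>A - {w}. adj_ind (induced E A) u v * (p u * p v))
     = (\<Sum>u\<in>A - {w}. \<Sum>v\<in>A - {w}. adj_ind (induced E A) u v * (q u * q v))"
    using pq by (intro sum.cong refl) simp
  ultimately have eq: "randic_index (induced E A) - (\<Sum>e\<in>induced E A. \<Prod>u\<in>e. p u)
     = (q w - p w) * (\<Sum>z\<in>N. p z)"
    using GA.randic_sum GA.edge_sum[of p] GA.adj_sum_split_vertex[OF w_in(1), of p]
      GA.adj_sum_split_vertex[OF w_in(1), of q]
    by (simp add: q_def N_def algebra_simps)
  have pz: "p z \<le> sqrt 2 / sqrt t" if "z \<in> N" for z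
  proof -
    have "real t \<le> 2 * real (degree E z)" using half[of z] that by (simp add: NA t_def)
    then have "sqrt t \<le> sqrt 2 * sqrt (degree E z)" by (metis real_sqrt_le_mono real_sqrt_mult)
    moreover have "t > 0" "degree E z > 0" using a1 at half[of z] that by (auto simp: NA t_def)
    ultimately show ?thesis by (simp add: p_def dw_def field_simps)
  qed
  have "(\<Sum>z\<in>N. p z) \<le> a * (sqrt 2 / sqrt t)"
    using sum_bounded_above[of N p "sqrt 2 / sqrt t"] pz by (simp add: NA a_def)
  moreover have "q w \<ge> p w" using degw a1 at by (auto simp: p_def q_def dw_def t_def intro!: divide_left_mono)
  ultimately have "(q w - p w) * (\<Sum>z\<in>N. p z) \<le> (q w - p w) * (a * (sqrt 2 / sqrt t))"
    by (intro mult_left_mono) auto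
  also have "\<dots> = sqrt 2 * (sqrt a / sqrt t - a / t)"
  proof -
    have "q w = 1 / sqrt a" "p w = 1 / sqrt t" using degw by (auto simp: q_def p_def dw_def t_def)
    moreover have "(1 / x - 1 / y) * (x * x * (sqrt 2 / y)) = sqrt 2 * (x / y - x * x / (y * y))"
      if "x > 0" "y > 0" for x y :: real
      using that by (simp add: field_simps)
    from this[of "sqrt a" "sqrt t"] have "(1 / sqrt a - 1 / sqrt t) * (a * (sqrt 2 / sqrt t))
        = sqrt 2 * (sqrt a / sqrt t - a / t)"
      using a1 at by simp
    ultimately show ?thesis by simp
  qed
  finally show "randic_index (induced E A) - (\<Sum>e\<in>induced E A. \<Prod>u\<in>e. dw E u)
    \<le> sqrt 2 * (sqrt a / sqrt t - a / t)" using eq by (simp add: p_def)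
qed

text \<open>The two increases add up to \<open>sqrt 2 * ((sqrt a + sqrt b) / sqrt t - 1)\<close>
  with \<open>a + b = t\<close>. The quotient is at most \<open>sqrt 2\<close>, which gives the
  constant \<open>2 - sqrt 2\<close>.\<close>

lemma randic_split:
  assumes half: "\<And>z. z \<in> nbrs E w \<Longrightarrow> degree E w \<le> 2 * degree E z"
    and n: "card A \<ge> 2" "card B \<ge> 2"
  shows "randic_index E \<ge> randic_index (induced E A) + randic_index (induced E B) - (2 - sqrt 2)"
proof -
  interpret S: vertex_split V E B A w by (rule vertex_split_swap)
  define a b t where "a = card (nbrs E w \<inter> A)" and "b = card (nbrs E w \<inter> B)" and "t = degree E w"
  note rA = randic_A[OF half n(1), folded a_def t_def]
  note rB = S.randic_A[OF half n(2), folded b_def t_def]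
  have "nbrs E w = (nbrs E w \<inter> A) \<union> (nbrs E w \<inter> B)" using nbrs_subset cover by auto
  then have t: "t = a + b"
    using card_Un_disjoint[of "nbrs E w \<inter> A" "nbrs E w \<inter> B"] meet nbrs_irrefl[of w] finite_nbrs[of w]
    unfolding t_def degree_nbrs a_def b_def by fastforce
  have tpos: "t > 0" using t rA by simp
  have "E = induced E A \<union> induced E B" using no_cross by (auto simp: induced_def)
  moreover have "induced E A \<inter> induced E B = {}"
  proof -
    have "e \<subseteq> {w} \<Longrightarrow> e \<notin> E" for e
      using simple by (auto simp: simple_graph_def subset_singleton_iff)
    then show ?thesis using meet by (auto simp: induced_def)
  qed
  ultimately have "randic_index E = (\<Sum>e\<in>induced E A. \<Prod>u\<in>e. dw E u) + (\<Sum>e\<in>induced E B. \<Prod>u\<in>e. dw E u)"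
    unfolding randic_edges using finite_E sum.union_disjoint[of "induced E A" "induced E B"]
    by (metis (no_types) finite_Un)
  then have "randic_index (induced E A) + randic_index (induced E B) - randic_index E
      \<le> sqrt 2 * (sqrt a / sqrt t - a / t) + sqrt 2 * (sqrt b / sqrt t - b / t)"
    using rA rB by linarith
  also have "\<dots> = sqrt 2 * ((sqrt a + sqrt b) / sqrt t - 1)"
  proof -
    have "real a / t + real b / t = 1" using tpos t by (auto simp: add_divide_distrib[symmetric])
    moreover have "sqrt 2 * (x - x') + sqrt 2 * (y - y') = sqrt 2 * (x + y - (x' + y'))" for x x' y y' :: real
      by (simp add: algebra_simps)
    ultimately show ?thesis by (simp add: add_divide_distrib)
  qed
  also have "\<dots> \<le> sqrt 2 * (sqrt 2 - 1)"
  proof -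
    have "(sqrt a + sqrt b)\<^sup>2 \<le> 2 * real t"
      using sum_squares_ge_zero[of "sqrt a - sqrt b" 0] t
      by (simp add: power2_eq_square algebra_simps)
    then have "sqrt a + sqrt b \<le> sqrt (2 * real t)" by (simp add: real_le_rsqrt)
    then have "(sqrt a + sqrt b) / sqrt t \<le> sqrt 2"
      using tpos by (simp add: real_sqrt_mult pos_divide_le_eq)
    then show ?thesis by simp
  qed
  finally show ?thesis by (simp add: algebra_simps)
qed

end

section \<open>Paths and cut vertices\<close>

context cgraph
begin

text \<open>All distances from \<open>x\<close> up to the diameter occur, and there are as many of
  them as vertices, so the distance from \<open>x\<close> numbers the vertices. A geodesic to
  \<open>v\<close> must then pass through the only vertex one layer below.\<close>

lemma ordering_if_max_diameter:
  assumes "diameter V E + 1 = card V"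
  obtains f where "bij_betw f V {..<card V}"
    and "\<And>u v. u \<in> V \<Longrightarrow> v \<in> V \<Longrightarrow> {u, v} \<in> E \<longleftrightarrow> f v = Suc (f u) \<or> f u = Suc (f v)"
proof -
  obtain x y where xy: "x \<in> V" "y \<in> V" "graph_dist E x y = diameter V E"
    using diameter_attained .
  define f where "f = graph_dist E x"
  have img: "f ` V = {..<card V}"
  proof
    show "f ` V \<subseteq> {..<card V}"
      using dist_le_diameter[OF xy(1)] assms by (fastforce simp: f_def)
    show "{..<card V} \<subseteq> f ` V"
    proof
      fix i assume "i \<in> {..<card V}"
      then have "i \<le> graph_dist E x y" using xy assms by simp
      then obtain v where "v \<in> V" "f v = i"
        unfolding f_def by (rule geodesic_vertex[OF xy(1,2)])
      then show "i \<in> f ` V" by blast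
    qed
  qed
  then have bij: "bij_betw f V {..<card V}"
    by (simp add: bij_betw_def finite_V eq_card_imp_inj_on)
  then have inj: "inj_on f V" by (simp add: bij_betw_def)
  have pred: "{u, v} \<in> E" if uV: "u \<in> V" and vV: "v \<in> V" and suc: "f v = Suc (f u)" for u v
  proof -
    obtain p where p: "p \<in> V" "graph_dist E x p = f u" "graph_dist E p v = f v - f u"
      using geodesic_vertex[OF xy(1) vV, of "f u"] suc by (auto simp: f_def)
    then have "p = u" using inj uV by (auto simp: f_def inj_on_def)
    with p suc have "graph_dist E u v = 1" by simp
    then show ?thesis using dist_walk[OF uV vV] by (simp add: adj_rel_def)
  qed
  have "{u, v} \<in> E \<longleftrightarrow> f v = Suc (f u) \<or> f u = Suc (f v)" if "u \<in> V" "v \<in> V" for u v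
  proof
    assume e: "{u, v} \<in> E"
    then have "f v \<le> f u + 1" "f u \<le> f v + 1"
      using dist_adj_step[OF xy(1), of u v] dist_adj_step[OF xy(1), of v u]
      by (auto simp: f_def insert_commute)
    moreover have "f u \<noteq> f v" using edge_neq[OF e] inj that by (auto simp: inj_on_def)
    ultimately show "f v = Suc (f u) \<or> f u = Suc (f v)" by linarith
  next
    show "f v = Suc (f u) \<or> f u = Suc (f v) \<Longrightarrow> {u, v} \<in> E"
      using pred[of u v] pred[of v u] that by (auto simp: insert_commute)
  qed
  with bij show ?thesis using that by blast
qed

text \<open>A path has two end edges of weight \<open>1 / sqrt 2\<close> and inner edges of weight
  1/2; with two vertices the single edge has weight 1.\<close>

lemma randic_ordered:
  assumes bij: "bij_betw f V {..<card V}" and n: "card V \<ge> 2"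
    and adj: "\<And>u v. u \<in> V \<Longrightarrow> v \<in> V \<Longrightarrow> {u, v} \<in> E \<longleftrightarrow> f v = Suc (f u) \<or> f u = Suc (f v)"
  shows "randic_index E = (if card V = 2 then 1 else (real (card V) - 3) / 2 + sqrt 2)"
proof -
  define n where "n = card V"
  define g where "g = inv_into V f"
  have gV: "g i \<in> V" and fg: "f (g i) = i" if "i < n" for i
    using that bij bij_betw_inv_into_right[OF bij, of i] bij_betwE[OF bij_betw_inv_into[OF bij]]
    by (auto simp: g_def n_def)
  have gf: "g (f v) = v" and fn: "f v < n" if "v \<in> V" for v
    using that bij bij_betw_inv_into_left[OF bij that] bij_betwE[OF bij] by (auto simp: g_def n_def)
  have nb: "nbrs E (g i) = g ` {j. j < n \<and> (j = Suc i \<or> i = Suc j)}" if "i < n" for i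
  proof -
    have "v \<in> nbrs E (g i) \<longleftrightarrow> v \<in> g ` {j. j < n \<and> (j = Suc i \<or> i = Suc j)}" for v
    proof
      assume v: "v \<in> nbrs E (g i)"
      then have "v \<in> V" using nbrs_subset by blast
      then have "f v = Suc i \<or> i = Suc (f v)" using v adj[OF gV[OF that]] fg[OF that] by (simp add: nbrs_def)
      then show "v \<in> g ` {j. j < n \<and> (j = Suc i \<or> i = Suc j)}"
        using gf[OF \<open>v \<in> V\<close>] fn[OF \<open>v \<in> V\<close>] by (intro image_eqI[of _ _ "f v"]) auto
    next
      assume "v \<in> g ` {j. j < n \<and> (j = Suc i \<or> i = Suc j)}"
      then obtain j where "v = g j" "j < n" "j = Suc i \<or> i = Suc j" by blast
      then show "v \<in> nbrs E (g i)" using adj[OF gV gV, of i j] that by (auto simp: nbrs_def fg)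
    qed
    then show ?thesis by blast
  qed
  have inj: "inj_on g {..<n}" using fg by (metis inj_onI lessThan_iff)
  have deg: "degree E (g i) = (if i = 0 \<or> Suc i = n then 1 else 2)" if "i < n" for i
  proof -
    have "degree E (g i) = card {j. j < n \<and> (j = Suc i \<or> i = Suc j)}"
      unfolding degree_nbrs nb[OF that] using inj by (intro card_image) (auto simp: inj_on_def)
    also have "{j. j < n \<and> (j = Suc i \<or> i = Suc j)} = (if Suc i < n then {Suc i} else {}) \<union> (if i = 0 then {} else {i - 1})"
      using that by auto
    also have "card \<dots> = (if i = 0 \<or> Suc i = n then 1 else 2)"
      using that n by (auto simp: n_def card_insert_if)
    finally show ?thesis .
  qed
  have "bij_betw (\<lambda>i. {g i, g (Suc i)}) {..<n - 1} E"
    unfolding bij_betw_def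
  proof
    have eq: "{g i, g (Suc i)} = {g j, g (Suc j)} \<Longrightarrow> i = j" if "i < n - 1" "j < n - 1" for i j
    proof -
      assume "{g i, g (Suc i)} = {g j, g (Suc j)}"
      then have "f ` {g i, g (Suc i)} = f ` {g j, g (Suc j)}" by simp
      then have "{i, Suc i} = {j, Suc j}" using that by (simp add: fg)
      then show "i = j" by (auto simp: doubleton_eq_iff)
    qed
    then show "inj_on (\<lambda>i. {g i, g (Suc i)}) {..<n - 1}" by (auto intro!: inj_onI)
    show "(\<lambda>i. {g i, g (Suc i)}) ` {..<n - 1} = E"
    proof
      show "(\<lambda>i. {g i, g (Suc i)}) ` {..<n - 1} \<subseteq> E" using adj gV fg by auto
      show "E \<subseteq> (\<lambda>i. {g i, g (Suc i)}) ` {..<n - 1}"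
      proof
        fix e assume e: "e \<in> E"
        then have "card e = 2" using simple by (simp add: simple_graph_def)
        then obtain u v where uv: "e = {u, v}" by (meson card_2_iff)
        then have V: "u \<in> V" "v \<in> V" using e edge_ends by auto
        have "f v = Suc (f u) \<or> f u = Suc (f v)" using adj[OF V] e uv by simp
        then have "e = {g (f u), g (Suc (f u))} \<and> f u < n - 1 \<or> e = {g (f v), g (Suc (f v))} \<and> f v < n - 1"
          using gf[OF V(1)] gf[OF V(2)] fn[OF V(1)] fn[OF V(2)] uv by (auto simp: insert_commute)
        then show "e \<in> (\<lambda>i. {g i, g (Suc i)}) ` {..<n - 1}" by blast
      qed
    qed
  qed
  then have "randic_index E = (\<Sum>i<n - 1. \<Prod>u\<in>{g i, g (Suc i)}. dw E u)"
    unfolding randic_edges by (rule sum.reindex_bij_betw[symmetric])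
  also have "\<dots> = (\<Sum>i<n - 1. dw E (g i) * dw E (g (Suc i)))"
  proof (rule sum.cong)
    fix i assume "i \<in> {..<n - 1}"
    then have "g i \<noteq> g (Suc i)" using fg[of i] fg[of "Suc i"] by fastforce
    then show "(\<Prod>u\<in>{g i, g (Suc i)}. dw E u) = dw E (g i) * dw E (g (Suc i))" by simp
  qed simp
  also have "\<dots> = (if n = 2 then 1 else (real n - 3) / 2 + sqrt 2)"
  proof (cases "n = 2")
    case True
    then show ?thesis by (simp add: deg dw_def)
  next
    case False
    \<comment> \<open>With \<open>n = m + 3\<close>, exactly \<open>m\<close> inner edges remain
      once the first and the last edge are split off.\<close>
    then obtain m where m: "n = m + 3" using n n_def by (metis add.commute le_Suc_ex le_antisym not_less_eq_eq numeral_2_eq_2 numeral_3_eq_3)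
    have "(\<Sum>i<n - 1. dw E (g i) * dw E (g (Suc i)))
        = dw E (g 0) * dw E (g 1) + (\<Sum>i<m. dw E (g (Suc i)) * dw E (g (Suc (Suc i)))) + dw E (g (Suc m)) * dw E (g (Suc (Suc m)))"
    proof -
      have "n - 1 = Suc (Suc m)" using m by simp
      then show ?thesis
        using sum.lessThan_Suc_shift[of "\<lambda>i. dw E (g i) * dw E (g (Suc i))" "Suc m"] by simp
    qed
    also have "(\<Sum>i<m. dw E (g (Suc i)) * dw E (g (Suc (Suc i)))) = (\<Sum>i<m. 1 / 2)"
      using m by (intro sum.cong) (simp_all add: deg dw_def)
    also have "dw E (g 0) * dw E (g 1) = sqrt 2 / 2" using m by (simp add: deg dw_def real_div_sqrt field_simps)
    also have "dw E (g (Suc m)) * dw E (g (Suc (Suc m))) = sqrt 2 / 2"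
      using m by (simp add: deg dw_def field_simps)
    finally show ?thesis using m by (simp add: field_simps)
  qed
  finally show ?thesis by (simp add: n_def)
qed

lemma randic_max_diameter:
  assumes "diameter V E + 1 = card V" "card V \<ge> 2"
  shows "randic_index E = (if card V = 2 then 1 else (real (card V) - 3) / 2 + sqrt 2)"
  using ordering_if_max_diameter[OF assms(1)] randic_ordered[OF _ assms(2)] by metis

text \<open>The number \<open>f\<close> changes by at most 1 along an edge, so the first and last
  vertices are at distance at least \<open>card V - 1\<close>.\<close>

lemma max_diameter_if_ordered:
  assumes bij: "bij_betw f V {..<card V}"
    and adj: "\<And>u v. u \<in> V \<Longrightarrow> v \<in> V \<Longrightarrow> {u, v} \<in> E \<longleftrightarrow> f v = Suc (f u) \<or> f u = Suc (f v)"
  shows "diameter V E + 1 = card V"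
proof -
  have pos: "card V > 0" using nonempty finite_V by (simp add: card_gt_0_iff)
  have img: "f ` V = {..<card V}" using bij by (simp add: bij_betw_def)
  have "0 \<in> f ` V" "card V - 1 \<in> f ` V" using pos by (auto simp: img)
  then obtain x y where xy: "x \<in> V" "y \<in> V" "f x = 0" "f y = card V - 1" by (metis imageE)
  have "f v \<le> f x + k" if "(x, v) \<in> adj_rel E ^^ k" for v k
    using that
  proof (induction k arbitrary: v)
    case (Suc k)
    then obtain u where u: "(x, u) \<in> adj_rel E ^^ k" "{u, v} \<in> E" by (auto simp: adj_rel_def)
    then have "f v \<le> Suc (f u)" using adj[of u v] edge_ends[of u v] by auto
    with Suc.IH[OF u(1)] show ?case by simp
  qed simp
  from this[OF dist_walk[OF xy(1,2)]] have "card V - 1 \<le> diameter V E"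
    using xy dist_le_diameter[OF xy(1,2)] by simp
  then show ?thesis using diameter_less_card by simp
qed

text \<open>Replaces isomorphism with a path by a numerical condition, the only form in which paths
  enter the remaining argument.\<close>

lemma max_diameter_iff_path:
  assumes "card V \<ge> 3"
  shows "diameter V E + 1 = card V \<longleftrightarrow> (\<exists>n\<ge>3. graph_iso V E (path_verts n) (path_edges n))"
proof -
  have pe: "{i, j} \<in> path_edges n \<longleftrightarrow> j = Suc i \<or> i = Suc j" if "i < n" "j < n" for i j n
    using that by (auto simp: path_edges_def doubleton_eq_iff)
  show ?thesis
  proof
    assume "diameter V E + 1 = card V"
    then obtain f where f: "bij_betw f V {..<card V}"
      "\<And>u v. u \<in> V \<Longrightarrow> v \<in> V \<Longrightarrow> {u, v} \<in> E \<longleftrightarrow> f v = Suc (f u) \<or> f u = Suc (f v)"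
      using ordering_if_max_diameter by metis
    have "f v < card V" if "v \<in> V" for v using bij_betwE[OF f(1)] that by blast
    then have "graph_iso V E (path_verts (card V)) (path_edges (card V))"
      unfolding graph_iso_def path_verts_def using f pe by blast
    then show "\<exists>n\<ge>3. graph_iso V E (path_verts n) (path_edges n)" using assms by blast
  next
    assume "\<exists>n\<ge>3. graph_iso V E (path_verts n) (path_edges n)"
    then obtain n f where f: "bij_betw f V {..<n}"
      "\<And>u v. u \<in> V \<Longrightarrow> v \<in> V \<Longrightarrow> {u, v} \<in> E \<longleftrightarrow> {f u, f v} \<in> path_edges n"
      unfolding graph_iso_def path_verts_def by blast
    have n: "card V = n" using bij_betw_same_card[OF f(1)] by simp
    have "f v < n" if "v \<in> V" for v using bij_betwE[OF f(1)] that by blast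
    then show "diameter V E + 1 = card V"
      using f pe n by (intro max_diameter_if_ordered[of f]) auto
  qed
qed

text \<open>One side is a component of the graph without \<open>w\<close>, the other is everything
  else; \<open>w\<close> is added to both.\<close>

lemma split_at_cut_vertex:
  assumes w: "w \<in> V" and n: "card V \<ge> 2" and cut: "\<not> cgraph (V - {w}) (induced E (V - {w}))"
  obtains A B where "vertex_split V E A B w" "card A \<ge> 2" "card B \<ge> 2"
proof -
  let ?R = "(adj_rel (induced E (V - {w})))\<^sup>*"
  have symR: "(a, b) \<in> ?R \<Longrightarrow> (b, a) \<in> ?R" for a b
    using symD[OF sym_rtrancl[OF sym_adj_rel]] .
  have "V - {w} \<noteq> {}" using n by (metis Diff_eq_empty_iff card_1_singleton_iff card_mono finite.emptyI finite_insert is_singletonI is_singleton_altdef not_less_eq_eq numeral_2_eq_2 One_nat_def)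
  then obtain u v where uv: "u \<in> V - {w}" "v \<in> V - {w}" "(u, v) \<notin> ?R"
    using cut sgraph_induced[of "V - {w}"]
    by (auto simp: cgraph_def cgraph_axioms_def graph_connected_def)
  define A where "A = insert w {a \<in> V - {w}. (u, a) \<in> ?R}"
  define B where "B = insert w {a \<in> V - {w}. (u, a) \<notin> ?R}"
  have cross: "e \<subseteq> A \<or> e \<subseteq> B" if e: "e \<in> E" for e
  proof -
    have "card e = 2" using simple e by (simp add: simple_graph_def)
    then obtain a b where ab: "e = {a, b}" by (meson card_2_iff)
    then have V: "a \<in> V" "b \<in> V" using e edge_ends by auto
    show ?thesis
    proof (cases "a = w \<or> b = w")
      case True
      then show ?thesis using V ab by (auto simp: A_def B_def)
    next
      case False
      then have "(a, b) \<in> ?R" using e ab V by (auto simp: adj_rel_def induced_edge)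
      then have "(u, a) \<in> ?R \<longleftrightarrow> (u, b) \<in> ?R" using symR rtrancl_trans by metis
      then show ?thesis using V ab False by (auto simp: A_def B_def)
    qed
  qed
  have "V = A \<union> B" using w by (auto simp: A_def B_def)
  moreover have "A \<inter> B = {w}" by (auto simp: A_def B_def)
  ultimately have "vertex_split V E A B w"
    using cross by (intro vertex_split.intro vertex_split_axioms.intro cgraph_axioms)
  moreover have "finite A" "finite B" using finite_V by (auto simp: A_def B_def)
  moreover have "{w, u} \<subseteq> A" "{w, v} \<subseteq> B" "w \<noteq> u" "w \<noteq> v" using uv by (auto simp: A_def B_def)
  ultimately show ?thesis using that card_mono[of A "{w, u}"] card_mono[of B "{w, v}"] by simp
qed

text \<open>If \<open>e\<close> were a cut vertex, it would have a neighbour on either side; its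
  only neighbour would then lie in both sides, which share nothing but \<open>e\<close>.\<close>

lemma leaf_removal_connected:
  assumes e: "e \<in> V" "degree E e = 1" and n: "card V \<ge> 2"
  shows "cgraph (V - {e}) (induced E (V - {e}))"
proof (rule ccontr)
  assume "\<not> ?thesis"
  then obtain A B where s: "vertex_split V E A B e" "card A \<ge> 2" "card B \<ge> 2"
    using split_at_cut_vertex[OF e(1) n] by blast
  interpret SA: vertex_split V E A B e by (rule s)
  interpret SB: vertex_split V E B A e by (rule SA.vertex_split_swap)
  have "1 \<le> card (nbrs E e \<inter> A)"
    using cgraph.degree_pos[OF SA.cgraph_A SA.w_in(1) s(2)] degree_induced[OF SA.A_subset SA.w_in(1)] by simp
  moreover have "1 \<le> card (nbrs E e \<inter> B)"
    using cgraph.degree_pos[OF SB.cgraph_A SB.w_in(1) s(3)] degree_induced[OF SB.A_subset SB.w_in(1)] by simp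
  moreover obtain f where "nbrs E e = {f}" using e by (metis card_1_singletonE degree_nbrs)
  ultimately have "f \<in> A \<inter> B" by (metis Int_iff card.empty Int_insert_left_if0 Int_empty_left not_one_le_zero)
  then show False using SA.meet \<open>nbrs E e = {f}\<close> nbrs_irrefl[of e] by auto
qed

lemma degree_removed:
  assumes "w \<in> V" "v \<in> V - {w}"
  shows "degree (induced E (V - {w})) v = degree E v - (if v \<in> nbrs E w then 1 else 0)"
proof -
  have "nbrs E v \<inter> (V - {w}) = nbrs E v - {w}" using nbrs_subset by auto
  then show ?thesis
    using assms degree_induced[of "V - {w}" v] finite_nbrs[of v] nbrs_sym[of v w]
    by (simp add: degree_nbrs)
qed

lemma nbr_degree_ge_2:
  assumes "w \<in> V" "z \<in> nbrs E w" "card V \<ge> 3" "cgraph (V - {w}) (induced E (V - {w}))"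
  shows "degree E z \<ge> 2"
proof -
  have z: "z \<in> V - {w}" using assms(2) nbrs_subset nbrs_irrefl by auto
  have "1 \<le> degree (induced E (V - {w})) z"
    using cgraph.degree_pos[OF assms(4) z] assms(1,3) by simp
  then show ?thesis using degree_removed[OF assms(1) z] assms(2) by simp
qed

end

section \<open>The minimal counterexample\<close>

text \<open>The square grows by a factor below 2 in each step, and at \<open>k = 0\<close> the claim
  is 289 \<le> 320.\<close>

lemma exponential_growth: "(2 * k + 17)\<^sup>2 \<le> 5 * (2 :: nat) ^ (k + 6)"
proof (induction k)
  case (Suc k)
  have "(2 * Suc k + 17)\<^sup>2 \<le> 2 * (2 * k + 17)\<^sup>2" by (simp add: power2_eq_square algebra_simps)
  also have "\<dots> \<le> 2 * (5 * 2 ^ (k + 6))" using Suc by (intro mult_left_mono) auto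
  finally show ?case by (simp add: power_add)
qed (simp add: power2_eq_square)

text \<open>The right side bounds a sum of square roots of \<open>n\<close> degrees from below when
  all but four of them are at least 5 and the others at least 1. The left side is what that sum
  would exceed if the slack were at least 1/5.\<close>

lemma dense_numeric:
  fixes n D \<Delta> :: nat
  assumes \<Delta>: "\<Delta> \<ge> 5" and n: "\<Delta> + D \<le> n + 1"
    and growth: "D \<ge> 4 \<Longrightarrow> 2 ^ (D div 2 - 1) < \<Delta>"
  shows "2 * sqrt \<Delta> * (D / 2 + sqrt 2 - 1 + 1 / 5) \<le> (real n - 4) * sqrt 5 + 4"
proof -
  define s c where "s = sqrt \<Delta>" and "c = sqrt 5"
  have s2: "s * s = \<Delta>" and c2: "c * c = 5" by (simp_all add: s_def c_def)
  have sc: "s \<ge> c" using \<Delta> by (simp add: s_def c_def)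
  have c1: "559 / 250 \<le> c" "c \<le> 22361 / 10000"
    unfolding c_def by (rule real_le_rsqrt, simp add: power2_eq_square) (rule real_le_lsqrt; simp add: power2_eq_square)
  have "sqrt 2 \<le> 14143 / 10000" by (rule real_le_lsqrt; simp add: power2_eq_square)
  have s_ge: "s \<ge> real k" if "k * k \<le> \<Delta>" for k
  proof -
    have "(real k)\<^sup>2 \<le> \<Delta>" using of_nat_mono[OF that, where 'a = real] by (simp add: power2_eq_square)
    then show ?thesis unfolding s_def by (rule real_le_rsqrt)
  qed
  have sq: "2 * a * s - a * a \<le> s * s" for a
    using zero_le_square[of "s - a"] by (simp add: algebra_simps)
  \<comment> \<open>\<open>s * s\<close> is bounded below by its tangents at \<open>sqrt 5\<close>, 3 and 5; for large \<open>D\<close> the growth suffices.\<close>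
  have main: "s * (D + 12286 / 10000) \<le> (s * s + D - 5) * c + 4"
  proof -
    \<comment> \<open>After the tangent at \<open>sqrt 5\<close>, 3 or 5 is used, a linear function
      of \<open>s\<close> remains. Its slope is nonnegative up to \<open>D = 8\<close> at
      \<open>sqrt 5\<close> and up to \<open>D = 12\<close> at 3, and \<open>D = 13\<close> needs 5.
      The exponential estimate applies once \<open>D div 2\<close> is at least 7.\<close>
    consider "D \<le> 8" | "9 \<le> D" "D \<le> 12" | "D = 13" | "D \<ge> 14" by linarith
    then show ?thesis
    proof cases
      case 1
      have "(2 * c * s - c * c) * c = 2 * s * (c * c) - c * (c * c)" by (simp add: algebra_simps)
      moreover have "(2 * c * s - c * c) * c \<le> s * s * c" using sq[of c] c1 by (intro mult_right_mono) auto
      ultimately have "10 * s - 5 * c \<le> s * s * c" unfolding c2 by simp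
      \<comment> \<open>The constant is 10 - 1.2286, where 10 is the slope of the tangent times
        \<open>c\<close>.\<close>
      moreover have "0 \<le> (s - c) * (87714 / 10000 - D)" using sc 1 by (intro mult_nonneg_nonneg) auto
      then have "s * D \<le> c * D + 87714 / 10000 * s - 87714 / 10000 * c"
        by (simp add: algebra_simps diff_divide_distrib)
      moreover have "(s * s + D - 5) * c = s * s * c + c * D - 5 * c"
        "s * (D + 12286 / 10000) = s * D + 12286 / 10000 * s"
        by (simp_all add: algebra_simps)
      ultimately show ?thesis using c1 by linarith
    next
      case 2
      have "(2::nat) ^ 3 \<le> 2 ^ (D div 2 - 1)" using 2 by (intro power_increasing) auto
      then have s3: "s \<ge> 3" using growth 2 s_ge[of 3] by simp
      have "(6 * s - 9) * c \<le> s * s * c" using sq[of 3] c1 by (intro mult_right_mono) auto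
      moreover have "0 \<le> (s - 3) * (6 * c - 12286 / 10000 - D)" using s3 2 c1 by (intro mult_nonneg_nonneg) auto
      moreover have "real D * (3 - c) \<le> 12 * (3 - c)" using 2 c1 by (intro mult_right_mono) auto
      ultimately show ?thesis using c1 by (simp add: algebra_simps diff_divide_distrib)
    next
      case 3
      have s5: "s \<ge> 5" using growth 3 s_ge[of 5] by simp
      have "(10 * s - 25) * c \<le> s * s * c" using sq[of 5] c1 by (intro mult_right_mono) auto
      then have "10 * (s * c) - 25 * c \<le> s * s * c" by (simp add: algebra_simps)
      moreover have "0 \<le> (s - 5) * (10 * c - 142286 / 10000)" using s5 c1 by (intro mult_nonneg_nonneg) auto
      then have "142286 / 10000 * s + 50 * c - 142286 / 2000 \<le> 10 * (s * c)"
        by (simp add: algebra_simps diff_divide_distrib)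
      moreover have "(s * s + D - 5) * c = s * s * c + 8 * c" "s * (D + 12286 / 10000) = 142286 / 10000 * s"
        using 3 by (simp_all add: algebra_simps)
      ultimately show ?thesis using c1 by linarith
    next
      case 4
      have "(D + 2)\<^sup>2 \<le> (2 * (D div 2) + 3)\<^sup>2" by (intro power_mono) auto
      also have "\<dots> \<le> 5 * 2 ^ (D div 2 - 1)" 
      proof -
        have "2 * (D div 2) + 3 = 2 * (D div 2 - 7) + 17" "D div 2 - 1 = D div 2 - 7 + 6" using 4 by auto
        then show ?thesis using exponential_growth[of "D div 2 - 7"] by metis
      qed
      also have "\<dots> \<le> 5 * \<Delta>" using growth 4 by auto
      finally have "(real D + 2)\<^sup>2 \<le> 5 * real \<Delta>"
        by (metis (no_types) of_nat_add of_nat_le_iff of_nat_mult of_nat_numeral of_nat_power)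
      then have "real D + 2 \<le> c * s"
        unfolding c_def s_def real_sqrt_mult[symmetric] by (rule real_le_rsqrt)
      then have "s * (real D + 2) \<le> s * (c * s)" using sc c1 by (intro mult_left_mono) auto
      moreover have "5 * c \<le> real D * c" using 4 c1 by (intro mult_right_mono) auto
      moreover have "(s * s + D - 5) * c = s * (c * s) + real D * c - 5 * c"
        "s * (D + 12286 / 10000) = s * (real D + 2) - 7714 / 10000 * s"
        by (simp_all add: algebra_simps)
      ultimately show ?thesis using sc c1 by linarith
    qed
  qed
  have "2 * s * (D / 2 + sqrt 2 - 1 + 1 / 5) = s * (D + 2 * sqrt 2 - 8 / 5)"
    by (simp add: algebra_simps)
  \<comment> \<open>The constant is 2 * 1.4143 - 8/5.\<close>
  also have "\<dots> \<le> s * (D + 12286 / 10000)"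
    using \<open>sqrt 2 \<le> 14143 / 10000\<close> sc c1 by (intro mult_left_mono) auto
  also note main
  also have "(s * s + D - 5) * c + 4 \<le> (real n - 4) * c + 4"
  proof -
    have "real \<Delta> + real D \<le> real n + 1" using n by linarith
    then show ?thesis unfolding s2 using c1 by (intro add_right_mono mult_right_mono) auto
  qed
  finally show ?thesis by (simp add: s_def c_def)
qed

section \<open>Slack and the setting of a minimal counterexample\<close>

definition slack :: "'a set \<Rightarrow> 'a set set \<Rightarrow> real" where
  "slack V E = randic_index E - diameter V E / 2 - (sqrt 2 - 1)"

lemma sqrt2_bounds: "707 / 500 \<le> sqrt 2" "sqrt 2 \<le> 14143 / 10000"
  by (rule real_le_rsqrt, simp add: power2_eq_square) (rule real_le_lsqrt; simp add: power2_eq_square)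

lemma sqrt3_bounds: "433 / 250 \<le> sqrt 3" "sqrt 3 \<le> 17321 / 10000"
  by (rule real_le_rsqrt, simp add: power2_eq_square) (rule real_le_lsqrt; simp add: power2_eq_square)

text \<open>A single edge has positive slack, hence only an inequality for two vertices; it covers
  small graphs left over after a deletion.\<close>

lemma (in cgraph) slack_max_diameter:
  assumes "diameter V E + 1 = card V" "card V \<ge> 2"
  shows "slack V E \<ge> 0" and "card V \<ge> 3 \<Longrightarrow> slack V E = 0"
proof -
  have D: "real (diameter V E) = real (card V) - 1" using assms(1) by simp
  show "slack V E \<ge> 0" "card V \<ge> 3 \<Longrightarrow> slack V E = 0"
    using randic_max_diameter[OF assms] sqrt2_bounds by (auto simp: slack_def D field_simps)
qed

text \<open>A connected graph is a path iff \<open>diameter V E + 1 = card V\<close>; so \<open>nonpath\<close> below says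
  that the minimal counterexample is not a path.\<close>

locale minimal_graph = cgraph V E for V :: "'a set" and E +
  fixes x y :: 'a
  assumes xy: "x \<in> V" "y \<in> V" "graph_dist E x y = diameter V E"
    and nonpath: "diameter V E + 2 \<le> card V"
    and small: "slack V E < 1 / 5"
    and smaller: "\<And>V' :: 'a set. \<And>E'. card V' < card V \<Longrightarrow> cgraph V' E' \<Longrightarrow> diameter V' E' + 2 \<le> card V'
      \<Longrightarrow> slack V' E' \<ge> 1 / 5"
begin

lemma card_V: "card V \<ge> 3"
  using nonpath diameter_pos by linarith

section \<open>Deletions in a minimal counterexample\<close>

lemma card_removed: "w \<in> V \<Longrightarrow> card (V - {w}) + 1 = card V"
  using card_Suc_Diff1[OF finite_V] by simp

lemma degree_ge_1: "v \<in> V \<Longrightarrow> degree E v \<ge> 1"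
  using degree_pos card_V by simp

lemma x_neq_y: "x \<noteq> y"
  using diameter_pos card_V xy by auto

text \<open>If \<open>f\<close> had degree 2, deleting the leaf would lower the index by at least
  1/2 and the diameter by at most 1, so the slack would not grow and the rest would be a smaller
  counterexample or a path.\<close>

lemma leaf_nbr_degree:
  assumes e: "e \<in> V" "degree E e = 1" and f: "f \<in> nbrs E e"
  shows "degree E f \<ge> 3"
proof (rule ccontr)
  assume f_lt: "\<not> 3 \<le> degree E f"
  define E' where "E' = induced E (V - {e})"
  have c': "cgraph (V - {e}) E'"
    unfolding E'_def using leaf_removal_connected e card_V by simp
  interpret H: cgraph "V - {e}" E' by (rule c')
  have fV: "f \<in> V - {e}" using f nbrs_subset nbrs_irrefl by auto
  have "degree E f \<ge> 2" using nbr_degree_ge_2 e f card_V c' by (simp add: E'_def)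
  with f_lt have f2: "degree E f = 2" by simp
  have ne: "nbrs E e = {f}" using e f by (metis card_1_singletonE degree_nbrs singletonD)
  have n': "card (V - {e}) + 1 = card V" using card_removed e by simp
  \<comment> \<open>On three vertices the assumption \<open>nonpath\<close> forces diameter 1, and
    the leaf would have two neighbours.\<close>
  have n4: "card V \<ge> 4"
  proof (rule ccontr)
    assume "\<not> card V \<ge> 4"
    then have "diameter V E \<le> 1" using nonpath by simp
    have "V - {e} \<subseteq> nbrs E e"
    proof
      fix v assume v: "v \<in> V - {e}"
      then have "graph_dist E e v \<le> 1" "graph_dist E e v \<noteq> 0"
        using dist_le_diameter[OF e(1), of v] \<open>diameter V E \<le> 1\<close> dist_0_iff[OF e(1), of v] by auto
      then have "graph_dist E e v = 1" by simp
      then show "v \<in> nbrs E e" using dist_walk[OF e(1), of v] v by (simp add: adj_rel_def nbrs_def)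
    qed
    then have "card (V - {e}) \<le> 1" using ne card_mono[of "nbrs E e"] by simp
    then show False using n' card_V by simp
  qed
  have degf: "degree E' f = 1" using degree_removed[OF e(1) fV] ne f2 by (simp add: E'_def)
  have deg': "degree E' v = degree E v" if "v \<in> V - {e, f}" for v
    using degree_removed[OF e(1), of v] that ne by (simp add: E'_def)
  \<comment> \<open>Otherwise \<open>v\<close> would be a leaf of the remaining graph whose
    neighbour \<open>f\<close> also has degree 1 there, impossible in a connected graph with at
    least three vertices.\<close>
  have two: "degree E v \<ge> 2" if v: "v \<in> nbrs E f - {e}" for v
  proof (rule ccontr)
    assume "\<not> 2 \<le> degree E v"
    then have v_lt: "degree E v < 2" by simp
    have vV: "v \<in> V - {e, f}" using v nbrs_subset nbrs_irrefl by auto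
    then have "degree E v = 1" using degree_ge_1[of v] v_lt by simp
    then have v1: "degree E' v = 1" using deg' vV by simp
    have "f \<in> nbrs E' v"
      using v vV fV by (auto simp: E'_def nbrs_def induced_edge insert_commute)
    moreover have "cgraph (V - {e} - {v}) (induced E' (V - {e} - {v}))"
      using H.leaf_removal_connected[of v] v1 vV n4 n' by simp
    ultimately have "degree E' f \<ge> 2"
      using H.nbr_degree_ge_2[of v f] vV n4 n' by simp
    then show False using degf by simp
  qed
  have "dw E v + dw E' v \<le> 2 * (1 / sqrt 2)" if "v \<in> nbrs E f - {e}" for v
  proof -
    have "v \<in> V - {e, f}" using that nbrs_subset nbrs_irrefl by auto
    then have "dw E' v = dw E v" using deg' by (simp add: dw_def)
    moreover have "dw E v \<le> 1 / sqrt 2" using two[OF that] by (auto simp: dw_def intro!: divide_left_mono)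
    ultimately show ?thesis by simp
  qed
  then have "randic_index E - randic_index E' \<ge> (\<Sum>z\<in>nbrs E e. dw E z * (dw E e - 1 / sqrt 2 * phi (degree E z)))"
    using ne e c' card_V by (intro removal_gain) (auto simp: E'_def)
  \<comment> \<open>The value comes from \<open>phi 2 = sqrt 2 - 1\<close>.\<close>
  also have "(\<Sum>z\<in>nbrs E e. dw E z * (dw E e - 1 / sqrt 2 * phi (degree E z))) = 1 / 2"
    using ne e f2 by (simp add: dw_def phi_def field_simps)
  finally have gain: "randic_index E \<ge> randic_index E' + 1 / 2" by simp
  define D' where "D' = diameter (V - {e}) E'"
  have dH: "graph_dist E u v \<le> D'" if "u \<in> V - {e}" "v \<in> V - {e}" for u v
    using dist_induced[of "V - {e}" u v] c' that H.dist_le_diameter[OF that]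
    by (simp add: E'_def D'_def)
  have de: "graph_dist E e v \<le> D' + 1" if "v \<in> V" for v
  proof (cases "v = e")
    case False
    have "graph_dist E e f \<le> 1" using dist_adj[of e f] f by (simp add: nbrs_def)
    then show ?thesis
      using dist_triangle[OF e(1), of f v] dH[OF fV, of v] that False fV by simp
  qed simp
  have D: "diameter V E \<le> D' + 1"
  proof (rule diameter_leI)
    fix u v assume uv: "u \<in> V" "v \<in> V"
    consider "u = e" | "v = e" | "u \<noteq> e" "v \<noteq> e" by blast
    then show "graph_dist E u v \<le> D' + 1"
      using de[of u] de[of v] dH[of u v] dist_sym[of u v] uv by cases auto
  qed
  consider "D' + 2 \<le> card (V - {e})" | "D' + 1 = card (V - {e})"
    using H.diameter_less_card unfolding D'_def by linarith
  then show False
  proof cases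
    case 1
    then have "slack (V - {e}) E' \<ge> 1 / 5"
      using smaller[of "V - {e}" E'] c' n' by (simp add: D'_def)
    then show False using gain D small by (simp add: slack_def D'_def)
  next
    case 2
    \<comment> \<open>For a path only nonnegative slack is available, but then
      \<open>nonpath\<close> prevents the diameter from dropping, and the full 1/2 is
      gained.\<close>
    then have "slack (V - {e}) E' \<ge> 0"
      using H.slack_max_diameter(1) n4 n' by (simp add: D'_def)
    moreover have "diameter V E \<le> D'" using 2 nonpath n' by simp
    ultimately show False using gain small by (simp add: slack_def D'_def)
  qed
qed

text \<open>Otherwise deleting \<open>w\<close> would not increase the index: all second neighbours
  have weight at most \<open>2 / sqrt t\<close> before and after, and \<open>phi\<close> is at most
  1/2. The diameter does not drop, as \<open>x\<close> and \<open>y\<close> remain. By minimality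
  the rest is a path, where the gain can be estimated directly.\<close>

lemma noncut_nearby_low_degree:
  assumes w: "w \<in> V" "w \<noteq> x" "w \<noteq> y" and c': "cgraph (V - {w}) (induced E (V - {w}))"
  shows "degree E w \<ge> 5 \<and> (\<exists>z\<in>nbrs E w. \<exists>v\<in>nbrs E z - {w}. 4 * (degree E v - 1) < degree E w)"
proof (rule ccontr)
  assume neg: "\<not> ?thesis"
  define E' where "E' = induced E (V - {w})"
  define t where "t = degree E w"
  \<comment> \<open>Weights are at most 1, which suffices for \<open>t \<le> 4\<close> and is the
    sharper bound needed in the path case.\<close>
  define c where "c = (if t \<le> 4 then 1 else 2 / sqrt t)"
  have c'': "cgraph (V - {w}) E'" using c' by (simp add: E'_def)
  interpret H: cgraph "V - {w}" E' by (rule c'')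
  have n': "card (V - {w}) + 1 = card V" using card_removed w by simp
  have t1: "t \<ge> 1" using degree_ge_1 w by (simp add: t_def)
  have c_le: "c \<le> 2 / sqrt t"
  proof -
    have "sqrt t \<le> 2" if "t \<le> 4" using that real_sqrt_le_mono[of t 4] by simp
    then show ?thesis using t1 by (simp add: c_def)
  qed
  have dw1: "1 / sqrt (real k) \<le> 1" for k :: nat by (cases "k = 0") auto
  have bound: "(dw E v + dw E' v) / 2 \<le> c" if z: "z \<in> nbrs E w" and v: "v \<in> nbrs E z - {w}" for z v
  proof (cases "t \<le> 4")
    case True
    then show ?thesis using dw1[of "degree E v"] dw1[of "degree E' v"] by (simp add: dw_def c_def)
  next
    case False
    then have le: "t \<le> 4 * (degree E v - 1)" using neg z v by (force simp: t_def)
    have vV: "v \<in> V - {w}" using v nbrs_subset by auto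
    have *: "1 / sqrt (real k) \<le> 2 / sqrt t" if "degree E v - 1 \<le> k" for k
    proof -
      have "real t \<le> 4 * real k" using le that by linarith
      then have "sqrt t \<le> sqrt 4 * sqrt k" by (metis real_sqrt_le_mono real_sqrt_mult)
      moreover have "k > 0" using le that False by (intro gr0I) auto
      ultimately show ?thesis using t1 by (simp add: field_simps)
    qed
    \<comment> \<open>The \<open>- 1\<close> in the claim allows for \<open>v\<close> being adjacent
      to \<open>w\<close> itself.\<close>
    have "degree E v - 1 \<le> degree E' v" using degree_removed[OF w(1) vV] by (simp add: E'_def)
    then have "dw E v \<le> 2 / sqrt t" "dw E' v \<le> 2 / sqrt t" unfolding dw_def using * by auto
    then show ?thesis using False by (simp add: c_def)
  qed
  have gain: "randic_index E - randic_index E' \<ge> (\<Sum>z\<in>nbrs E w. dw E z * (dw E w - c * phi (degree E z)))"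
    using w c'' card_V bound by (intro removal_gain) (auto simp: E'_def)
  have dz: "degree E z \<ge> 2" if "z \<in> nbrs E w" for z using nbr_degree_ge_2[OF w(1) that card_V c'] .
  have "0 \<le> (\<Sum>z\<in>nbrs E w. dw E z * (dw E w - c * phi (degree E z)))"
  proof (intro sum_nonneg mult_nonneg_nonneg dw_nonneg)
    fix z assume "z \<in> nbrs E w"
    then have "1 \<le> degree E z" using dz by fastforce
    then have "c * phi (degree E z) \<le> 2 / sqrt t * (1 / 2)"
      using c_le by (intro mult_mono phi_le_half phi_nonneg) auto
    then show "0 \<le> dw E w - c * phi (degree E z)" by (simp add: dw_def t_def)
  qed
  with gain have R: "randic_index E' \<le> randic_index E" by simp
  define D' where "D' = diameter (V - {w}) E'"
  have "graph_dist E x y \<le> D'"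
    using dist_induced[of "V - {w}" x y] c' xy w H.dist_le_diameter[of x y]
    by (simp add: E'_def D'_def)
  then have D: "diameter V E \<le> D'" using xy by simp
  have "\<not> D' + 2 \<le> card (V - {w})"
    using smaller[of "V - {w}" E'] c'' n' R D small by (auto simp: slack_def D'_def)
  then have D'n: "D' + 1 = card (V - {w})" using H.diameter_less_card by (simp add: D'_def)
  then have s0: "slack (V - {w}) E' \<ge> 0" using H.slack_max_diameter(1) n' card_V by (simp add: D'_def)
  \<comment> \<open>A larger diameter of the rest would already give slack at least 1/2.\<close>
  then have "diameter V E = D'"
    using D R small by (cases "diameter V E + 1 \<le> D'") (auto simp: slack_def D'_def)
  then have "t \<le> 3" using degree_diameter[OF w(1)] D'n n' by (simp add: t_def)
  \<comment> \<open>In the remaining path degrees are at most 2, so neighbours of \<open>w\<close>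
    have degree at most 3. The resulting gain is at least 1/5, with \<open>t = 3\<close> the
    tightest case.\<close>
  have "(\<Sum>z\<in>nbrs E w. 1 / sqrt 3 * (1 / sqrt t - 9 / 20)) \<le> (\<Sum>z\<in>nbrs E w. dw E z * (dw E w - c * phi (degree E z)))"
  proof (intro sum_mono mult_mono dw_nonneg)
    fix z assume z: "z \<in> nbrs E w"
    then have zV: "z \<in> V - {w}" using nbrs_subset nbrs_irrefl by auto
    have "degree E' z \<le> 2" using H.degree_diameter[OF zV] D'n by (simp add: D'_def)
    then have d3: "degree E z \<le> 3" using degree_removed[OF w(1) zV] z by (simp add: E'_def)
    have d2: "degree E z \<ge> 2" using dz z .
    show "1 / sqrt 3 \<le> dw E z" using d2 d3 by (auto simp: dw_def intro!: divide_left_mono)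
    show "1 / sqrt t - 9 / 20 \<le> dw E w - c * phi (degree E z)"
      using phi_le_small[of "degree E z"] d2 d3 \<open>t \<le> 3\<close> by (simp add: dw_def t_def c_def)
    have "sqrt t \<le> sqrt 3" using \<open>t \<le> 3\<close> by simp
    then have "9 * sqrt t \<le> 20" using sqrt3_bounds by linarith
    then show "0 \<le> 1 / sqrt t - 9 / 20" using t1 by (simp add: field_simps)
  qed
  also have "(\<Sum>z\<in>nbrs E w. 1 / sqrt 3 * (1 / sqrt t - 9 / 20)) = t * (1 / sqrt 3 * (1 / sqrt t - 9 / 20))"
    by (simp add: t_def degree_nbrs)
  finally have "t * (1 / sqrt 3 * (1 / sqrt t - 9 / 20)) \<le> randic_index E - randic_index E'"
    using gain by simp
  moreover have "t * (1 / sqrt 3 * (1 / sqrt t - 9 / 20)) \<ge> 1 / 5"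
  proof -
    have "t * (1 / sqrt t - 9 / 20) \<ge> sqrt 3 / 5"
    proof -
      have "t * (1 / sqrt t - 9 / 20) = sqrt t - 9 / 20 * t"
        using t1 by (simp add: right_diff_distrib real_div_sqrt)
      moreover have "t = 1 \<or> t = 2 \<or> t = 3" using t1 \<open>t \<le> 3\<close> by auto
      ultimately show ?thesis using sqrt2_bounds sqrt3_bounds by auto
    qed
    from divide_right_mono[OF this, of "sqrt 3"] show ?thesis by simp
  qed
  ultimately show False
    using s0 small \<open>diameter V E = D'\<close> unfolding slack_def D'_def by linarith
qed

lemma leaf_is_end:
  assumes "e \<in> V" "degree E e = 1"
  shows "e = x \<or> e = y"
  using noncut_nearby_low_degree[of e] leaf_removal_connected[OF assms] assms card_V by fastforce

text \<open>Removing or splitting at a special vertex may decrease the diameter too much.\<close>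

definition special :: "'a set" where
  "special = {x, y} \<union> (\<Union>l\<in>{l \<in> {x, y}. degree E l = 1}. nbrs E l)"

section \<open>Vertices away from the special ones\<close>

lemma special_subset: "special \<subseteq> V"
  using xy nbrs_subset by (auto simp: special_def)

text \<open>A path side has an end \<open>e\<close> other than \<open>w\<close>, which is a leaf of
  the whole graph and hence \<open>x\<close> or \<open>y\<close>. Its neighbour \<open>f\<close> is
  special, so it differs from \<open>w\<close> and keeps its degree of at least 3, too large for a
  path.\<close>

lemma split_side_nonpath:
  assumes w: "w \<notin> special" and s: "vertex_split V E A B w" and n: "card A \<ge> 2"
  shows "diameter A (induced E A) + 2 \<le> card A"
proof (rule ccontr)
  interpret S: vertex_split V E A B w by (rule s)
  interpret GA: cgraph A "induced E A" by (rule S.cgraph_A)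
  assume "\<not> ?thesis"
  then have D: "diameter A (induced E A) + 1 = card A" using GA.diameter_less_card by simp
  obtain a b where ab: "a \<in> A" "b \<in> A" "graph_dist (induced E A) a b = diameter A (induced E A)"
    using GA.diameter_attained .
  have "a \<noteq> b" using ab GA.diameter_pos[OF n] by auto
  have "graph_dist (induced E A) b a = diameter A (induced E A)" using ab GA.dist_sym by simp
  then have "degree (induced E A) a \<le> 1" "degree (induced E A) b \<le> 1"
    using ab D GA.degree_diameter_end[of a b] GA.degree_diameter_end[of b a] by auto
  with \<open>a \<noteq> b\<close> ab obtain e where e: "e \<in> A - {w}" "degree (induced E A) e \<le> 1" by blast
  have eV: "e \<in> V" using e S.A_subset by auto
  then have e1: "degree E e = 1" using e S.degree_A[OF e(1)] degree_ge_1[of e] by simp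
  then obtain f where f: "nbrs E e = {f}" by (metis card_1_singletonE degree_nbrs)
  have fA: "f \<in> A" using S.nbrs_A[OF e(1)] f by auto
  have "f \<noteq> w" using w leaf_is_end[OF eV e1] e1 f by (auto simp: special_def)
  then have "degree (induced E A) f \<ge> 3"
    using leaf_nbr_degree[OF eV e1, of f] S.degree_A[of f] fA f by simp
  then show False using GA.degree_diameter[OF fA] D by simp
qed

text \<open>Otherwise the graph splits at \<open>w\<close> into two smaller non-paths, each of slack
  at least 1/5, at a bounded cost in the index.\<close>

lemma cut_nbr_low_degree:
  assumes w: "w \<in> V" "w \<notin> special" and cut: "\<not> cgraph (V - {w}) (induced E (V - {w}))"
  shows "\<exists>z\<in>nbrs E w. 2 * degree E z < degree E w"
proof (rule ccontr)
  assume "\<not> ?thesis"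
  then have half: "degree E w \<le> 2 * degree E z" if "z \<in> nbrs E w" for z using that by force
  have "card V \<ge> 2" using card_V by simp
  then obtain A B where s: "vertex_split V E A B w" "card A \<ge> 2" "card B \<ge> 2"
    using split_at_cut_vertex[OF w(1) _ cut] by blast
  interpret SA: vertex_split V E A B w by (rule s)
  interpret SB: vertex_split V E B A w by (rule SA.vertex_split_swap)
  have fin: "finite A" "finite B" using finite_V SA.cover by auto
  have "card V + 1 = card A + card B"
    using card_Un_Int[OF fin] SA.cover SA.meet by simp
  then have less: "card A < card V" "card B < card V" using s by auto
  have "slack A (induced E A) \<ge> 1 / 5" "slack B (induced E B) \<ge> 1 / 5"
    using smaller[OF less(1) SA.cgraph_A] smaller[OF less(2) SB.cgraph_A]
      split_side_nonpath[OF w(2) s(1,2)] split_side_nonpath[OF w(2) SA.vertex_split_swap s(3)] by auto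
  moreover have "real (diameter V E) \<le> diameter A (induced E A) + diameter B (induced E B)"
    using SA.diameter_split by linarith
  moreover have "randic_index E \<ge> randic_index (induced E A) + randic_index (induced E B) - (2 - sqrt 2)"
    using SA.randic_split[OF half s(2,3)] .
  \<comment> \<open>The combined bound is \<open>2 / 5 + 2 * sqrt 2 - 3\<close>, about
    0.228.\<close>
  ultimately have "slack V E \<ge> 1 / 5" using sqrt2_bounds unfolding slack_def by linarith
  then show False using small by simp
qed

text \<open>At a cut vertex of degree at most 4 the neighbour of low degree would be a leaf, hence
  \<open>x\<close> or \<open>y\<close>, and \<open>w\<close> would be special.\<close>

lemma nonspecial_nearby_low_degree:
  assumes w: "w \<in> V" "w \<notin> special"
  shows "degree E w \<ge> 5" and "(\<exists>z\<in>nbrs E w. 2 * degree E z < degree E w) \<or>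
    (\<exists>z\<in>nbrs E w. \<exists>v\<in>nbrs E z - {w}. 4 * (degree E v - 1) < degree E w)"
proof -
  have "w \<noteq> x" "w \<noteq> y" using w by (auto simp: special_def)
  note noncut = noncut_nearby_low_degree[OF w(1) this]
  show "degree E w \<ge> 5"
  proof (cases "cgraph (V - {w}) (induced E (V - {w}))")
    case False
    then obtain z where z: "z \<in> nbrs E w" "2 * degree E z < degree E w" using cut_nbr_low_degree w by blast
    have zV: "z \<in> V" using z nbrs_subset by auto
    show ?thesis
    proof (rule ccontr)
      assume "\<not> ?thesis"
      then have z1: "degree E z = 1" using z degree_ge_1[OF zV] by simp
      moreover have "w \<in> nbrs E z" using z nbrs_sym by simp
      ultimately show False using leaf_is_end[OF zV z1] w by (auto simp: special_def)
    qed
  qed (use noncut in blast)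
  show "(\<exists>z\<in>nbrs E w. 2 * degree E z < degree E w) \<or>
    (\<exists>z\<in>nbrs E w. \<exists>v\<in>nbrs E z - {w}. 4 * (degree E v - 1) < degree E w)"
    using noncut cut_nbr_low_degree[OF w] by blast
qed

text \<open>One step to a neighbour halves the degree bound and two steps quarter it, so descending
  to lower degrees costs one step per power of 2. For \<open>r < 2\<close> only special vertices
  qualify, since all others have degree at least 5.\<close>

lemma low_degree_near_special:
  "w \<in> V \<Longrightarrow> degree E w \<le> 2 ^ (r + 1) \<Longrightarrow> \<exists>s\<in>special. graph_dist E w s \<le> r"
proof (induction r arbitrary: w rule: less_induct)
  case (less r)
  note wV = less.prems(1)
  show ?case
  proof (cases "w \<in> special")
    case True
    then show ?thesis by (intro bexI[of _ w]) auto
  next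
    case False
    note low = nonspecial_nearby_low_degree[OF wV False]
    have "r \<ge> 2"
    proof (rule ccontr)
      assume "\<not> r \<ge> 2"
      then have "r = 0 \<or> r = 1" by auto
      then show False using low(1) less.prems(2) by auto
    qed
    then obtain q where r: "r = q + 2" by (metis add.commute le_Suc_ex)
    have adj1: "graph_dist E a b \<le> 1" if "b \<in> nbrs E a" for a b
      using that dist_adj by (simp add: nbrs_def)
    from low(2) show ?thesis
    proof (elim disjE bexE)
      fix z assume z: "z \<in> nbrs E w" "2 * degree E z < degree E w"
      then have zV: "z \<in> V" using nbrs_subset by auto
      have "degree E z \<le> 2 ^ (q + 1 + 1)" using z less.prems(2) r by simp
      then obtain s where s: "s \<in> special" "graph_dist E z s \<le> q + 1"
        using less.IH[of "q + 1" z] zV r by auto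
      then have "graph_dist E w s \<le> r"
        using dist_triangle[OF wV zV, of s] special_subset adj1[OF z(1)] r by auto
      with s show ?thesis by blast
    next
      fix z v assume z: "z \<in> nbrs E w" and v: "v \<in> nbrs E z - {w}" "4 * (degree E v - 1) < degree E w"
      have zV: "z \<in> V" and vV: "v \<in> V" using z v nbrs_subset by auto
      \<comment> \<open>The strict inequality absorbs the \<open>- 1\<close>.\<close>
      have "degree E v \<le> 2 ^ (q + 1)" using v less.prems(2) r by simp
      then obtain s where s: "s \<in> special" "graph_dist E v s \<le> q"
        using less.IH[of q v] vV r by auto
      then have "graph_dist E w s \<le> r"
        using dist_triangle[OF wV zV, of s] dist_triangle[OF zV vV, of s] special_subset adj1[OF z]
          adj1[of v z] v r by auto
      with s show ?thesis by blast
    qed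
  qed
qed

text \<open>The middle of a diametral geodesic is at distance at least \<open>m\<close> from
  \<open>x\<close> and \<open>y\<close>, hence at least \<open>m - 1\<close> from every special
  vertex.\<close>

lemma large_degree:
  assumes "diameter V E \<ge> 4"
  obtains u where "u \<in> V" "2 ^ (diameter V E div 2 - 1) < degree E u"
proof -
  define m where "m = diameter V E div 2"
  have m: "m \<ge> 2" "2 * m \<le> diameter V E" using assms by (auto simp: m_def)
  then obtain u where u: "u \<in> V" "graph_dist E x u = m" "graph_dist E u y = diameter V E - m"
    using geodesic_vertex[OF xy(1,2), of m] xy(3) by auto
  have far: "graph_dist E u l \<ge> m" if "l \<in> {x, y}" for l
    using that u m dist_sym[OF u(1) xy(1)] by auto
  have "\<not> degree E u \<le> 2 ^ (m - 2 + 1)"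
  proof
    assume "degree E u \<le> 2 ^ (m - 2 + 1)"
    then obtain s where s: "s \<in> special" "graph_dist E u s \<le> m - 2"
      using low_degree_near_special u by blast
    from s(1) consider "s \<in> {x, y}" | l where "l \<in> {x, y}" "s \<in> nbrs E l"
      by (auto simp: special_def)
    then show False
    proof cases
      case 1
      then show False using far s m by fastforce
    next
      case 2
      then have "{s, l} \<in> E" by (simp add: nbrs_def insert_commute)
      then have "graph_dist E u l \<le> graph_dist E u s + 1" using dist_adj_step u by blast
      then show False using far[OF 2(1)] s m by simp
    qed
  qed
  moreover have "m - 2 + 1 = diameter V E div 2 - 1" using m by (simp add: m_def)
  ultimately show ?thesis using that[of u] u(1) by (metis not_le)
qed

text \<open>Each of \<open>x\<close> and \<open>y\<close> contributes itself and, if it is a leaf,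
  its only neighbour. If these were all vertices, a leaf's neighbour, of degree at least 3, would
  leave no room for a second such neighbour.\<close>

lemma card_special: "card special \<le> 4"
  and special_neq: "special \<noteq> V"
proof -
  define N where "N l = (if degree E l = 1 then nbrs E l else {})" for l
  have S: "special = {x, y} \<union> (N x \<union> N y)" by (auto simp: special_def N_def)
  have N1: "card (N l) \<le> 1" for l by (auto simp: N_def degree_nbrs)
  have fin: "finite (N l)" for l by (auto simp: N_def finite_nbrs)
  have xy2: "card {x, y} = 2" using x_neq_y by simp
  show "card special \<le> 4"
    unfolding S using card_Un_le[of "{x, y}" "N x \<union> N y"] card_Un_le[of "N x" "N y"] N1[of x] N1[of y] xy2 by linarith
  have no: False if S': "V = {a, b} \<union> (N a \<union> N b)" and f: "f \<in> N a" and ab: "a \<in> V" "b \<in> V" for a b f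
  proof -
    have fa: "degree E a = 1" "f \<in> nbrs E a" using f by (auto simp: N_def split: if_splits)
    then have f3: "degree E f \<ge> 3" using leaf_nbr_degree ab by blast
    have fV: "f \<in> V" using fa nbrs_subset by auto
    have Na: "N a = {f}" using N1[of a] f fin[of a] by (metis One_nat_def card_le_Suc0_iff_eq singletonI subsetI subset_singletonD empty_iff insertI1 equals0D)
    have sub: "nbrs E f \<subseteq> V - {f}" using nbrs_subset nbrs_irrefl by auto
    have le: "card (nbrs E f) \<le> card (V - {f})" using sub finite_V by (intro card_mono) auto
    have "card V \<le> 4"
      unfolding S' using card_Un_le[of "{a, b}" "N a \<union> N b"] card_Un_le[of "N a" "N b"] N1[of a] N1[of b]
        card_insert_le_m1[of 2 "{b}" a] by simp
    then have "card V = 4" "card (V - {f}) \<le> card (nbrs E f)"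
      using f3 le card_removed[OF fV] unfolding degree_nbrs by linarith+
    \<comment> \<open>With four vertices and degree at least 3, \<open>f\<close> is adjacent to all
      others, in particular to the other end \<open>b\<close>; if \<open>b\<close> is a leaf, it
      adds no vertex beyond \<open>f\<close>.\<close>
    then have "nbrs E f = V - {f}" using sub finite_V by (intro card_seteq) auto
    have "f \<noteq> b"
    proof
      assume "f = b"
      then have "V = {a, b} \<union> N b" using S' Na by auto
      then have "card V \<le> 3" using card_Un_le[of "{a, b}" "N b"] N1[of b] card_insert_le_m1[of 2 "{b}" a] by simp
      then show False using \<open>card V = 4\<close> by simp
    qed
    then have "f \<in> nbrs E b" using \<open>nbrs E f = V - {f}\<close> ab nbrs_sym by blast
    then have "N b \<subseteq> {f}"
      using N1[of b] fin[of b] by (auto simp: N_def card_le_Suc0_iff_eq finite_nbrs split: if_splits)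
    then have "V \<subseteq> {a, b, f}" using S' Na by auto
    then have "card V \<le> 3" using card_mono[of "{a, b, f}" V] card_insert_le_m1[of 3 "{b, f}" a] card_insert_le_m1[of 2 "{f}" b] by simp
    then show False using \<open>card V = 4\<close> by simp
  qed
  show "special \<noteq> V"
  proof
    assume V: "special = V"
    have "N x = {}" using no[of x y] V S xy by (metis all_not_in_conv)
    moreover have "N y = {}" using no[of y x] V S xy by (metis all_not_in_conv insert_commute sup_commute)
    ultimately have "card V = 2" using V S xy2 by simp
    then show False using card_V by simp
  qed
qed

lemma no_minimal_graph: False
proof -
  define \<Delta> where "\<Delta> = Max (degree E ` V)"
  have \<Delta>: "degree E v \<le> \<Delta>" if "v \<in> V" for v using that finite_V by (simp add: \<Delta>_def)
  obtain u where u: "u \<in> V" "degree E u = \<Delta>"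
    using Max_in[of "degree E ` V"] finite_V nonempty unfolding \<Delta>_def
    by (metis finite_imageI image_is_empty imageE)
  obtain w where w: "w \<in> V" "w \<notin> special" using special_neq special_subset by blast
  have d5: "\<Delta> \<ge> 5" using nonspecial_nearby_low_degree(1)[OF w] \<Delta>[OF w(1)] by simp
  have "2 ^ (diameter V E div 2 - 1) < \<Delta>" if "diameter V E \<ge> 4"
    using large_degree[OF that] \<Delta> by (metis less_le_trans)
  then have "2 * sqrt \<Delta> * (diameter V E / 2 + sqrt 2 - 1 + 1 / 5) \<le> (real (card V) - 4) * sqrt 5 + 4"
    using d5 degree_diameter[OF u(1)] u(2) by (intro dense_numeric) auto
  also have "\<dots> \<le> real (card (V - special)) * sqrt 5 + real (card special) * 1"
  proof -
    have eq: "real (card (V - special)) = real (card V) - real (card special)"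
      using special_subset finite_V by (metis card_Diff_subset card_mono finite_subset of_nat_diff)
    \<comment> \<open>Having fewer than four special vertices only improves the bound, as each is
      counted with 1 instead of \<open>sqrt 5\<close>.\<close>
    have "0 \<le> (4 - real (card special)) * (sqrt 5 - 1)"
      using card_special by (intro mult_nonneg_nonneg) auto
    then show ?thesis unfolding eq by (simp add: algebra_simps)
  qed
  also have "\<dots> \<le> (\<Sum>z\<in>V - special. sqrt (degree E z)) + (\<Sum>z\<in>special. sqrt (degree E z))"
  proof (intro add_mono sum_bounded_below)
    show "sqrt 5 \<le> sqrt (degree E z)" if "z \<in> V - special" for z
      using nonspecial_nearby_low_degree(1)[of z] that by simp
    show "1 \<le> sqrt (degree E z)" if "z \<in> special" for z
      using degree_ge_1[of z] that special_subset by auto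
  qed
  also have "\<dots> = (\<Sum>z\<in>V. sqrt (degree E z))"
    using special_subset finite_V by (simp add: sum.subset_diff)
  also have "\<dots> \<le> 2 * sqrt \<Delta> * randic_index E"
    using randic_degree_bound[of \<Delta>] \<Delta> d5 by simp
  finally have "diameter V E / 2 + sqrt 2 - 1 + 1 / 5 \<le> randic_index E"
    using d5 by simp
  then show False using small by (simp add: slack_def)
qed

end

text \<open>Strong induction on the number of vertices supplies the minimality hypothesis; the
  vertex type stays fixed because all reductions pass to induced subgraphs.\<close>

lemma slack_nonpath:
  "cgraph V E \<Longrightarrow> diameter V E + 2 \<le> card V \<Longrightarrow> slack V E \<ge> 1 / 5"
proof (induction "card V" arbitrary: V E rule: less_induct)
  case less
  show ?case
  proof (rule ccontr)
    assume "\<not> ?thesis"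
    moreover obtain x y where "x \<in> V" "y \<in> V" "graph_dist E x y = diameter V E"
      using cgraph.diameter_attained[OF less.prems(1)] .
    ultimately have "minimal_graph V E x y"
      using less by (intro minimal_graph.intro minimal_graph_axioms.intro) auto
    then show False by (rule minimal_graph.no_minimal_graph)
  qed
qed

theorem theorem1:
  fixes V :: "'a set" and E :: "'a set set"
  assumes "simple_graph V E"
    and "graph_connected V E"
    and "card V \<ge> 3"
  shows "randic_index E - 1 / 2 * real (diameter V E) \<ge> sqrt 2 - 1
    \<and> (randic_index E - 1 / 2 * real (diameter V E) = sqrt 2 - 1
        \<longleftrightarrow> (\<exists>n\<ge>3. graph_iso V E (path_verts n) (path_edges n)))"
proof -
  interpret cgraph V E using assms by unfold_locales
  have iff: "diameter V E + 1 = card V \<longleftrightarrow> (\<exists>n\<ge>3. graph_iso V E (path_verts n) (path_edges n))"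
    using max_diameter_iff_path assms(3) .
  \<comment> \<open>Paths give equality, and for all other graphs the slack of 1/5 rules it
    out.\<close>
  consider "diameter V E + 2 \<le> card V" | "diameter V E + 1 = card V"
    using diameter_less_card by linarith
  then show ?thesis
  proof cases
    case 1
    then have "slack V E \<ge> 1 / 5" using slack_nonpath cgraph_axioms by blast
    moreover have "diameter V E + 1 \<noteq> card V" using 1 by simp
    ultimately show ?thesis unfolding iff[symmetric] by (simp add: slack_def)
  next
    case 2
    then have "slack V E = 0" using slack_max_diameter(2) assms(3) by simp
    then show ?thesis unfolding iff[symmetric] using 2 by (simp add: slack_def)
  qed
qed

end
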